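(* Let $\boldsymbol{s}=(s,s_L,s_U)$ be a scaling triple with associated constant $c_s$, and let $\mu$ be a symmetric Lévy measure on $\mathbb{R}^d$. Assume that $$\sup_{0<r<\infty}\; s(r)\int_{\mathbb{R}^d}(1\wedge|r^{-1}y|^2)\,\mu(dy)<\infty.$$ Then for every $\varphi\in\mathcal{S}(\mathbb{R}^d)$ with $\mathcal{F}[\varphi]\in C_c^\infty(B_{c_s}\setminus B_{c_s^{-1}})$ there exists a positive constant $N_2$ such that $$\|\psi^\mu(r^{-1}D)\varphi\|_{L_1(\mathbb{R}^d)}\le\frac{N_2}{s(r)}\qquad\forall r\in(0,1).$$
   Context: $B_r=\{x\in\mathbb{R}^d:|x|<r\}$; $\mathcal{F}[f](\xi)=(2\pi)^{-d/2}\int e^{-i\xi\cdot x}f(x)dx$ and $\mathcal{F}^{-1}$ is its inverse. A Lévy measure is a nonnegative Borel measure $\mu$ on $\mathbb{R}^d$ with $\mu(\{0\})=0$, $\int(1\wedge|y|^2)\mu(dy)<\infty$. $\psi^\mu(\xi)=\int_{\mathbb{R}^d}(e^{iy\cdot\xi}-1-iy\cdot\xi1_{|y|\le1})\mu(dy)$ and $\psi^\mu(r^{-1}D)\varphi=\mathcal{F}^{-1}[\psi^\mu(r^{-1}\cdot)\mathcal{F}[\varphi]]$. Scaling triple with $R_0\in[1,\infty]$: $s,s_L,s_U:(0,\infty)\to(0,\infty)$ are measurable, $s_L,s_U$ are non-decreasing with limit $0$ at $0$ and $\infty$ at $\infty$, and $s_L(R/r)\le s(R)/s(r)\le s_U(R/r)$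 for all $0<r\le R<R_0$. $m_s=\min\{m\in\mathbb{N}:s_L(2^m)>1\}$, $c_s=2^{m_s}$. *)

theory Defs
  imports "HOL-Analysis.Analysis"
begin

section \<open>Smooth functions and the Schwartz space\<close>

text \<open>A list of basis vectors plays the role of a multi-index: the function below is the
  corresponding iterated partial derivative.\<close>

primrec iterated_partial ::
  "'a::euclidean_space list \<Rightarrow> ('a \<Rightarrow> complex) \<Rightarrow> 'a \<Rightarrow> complex" where
  "iterated_partial [] f = f"
| "iterated_partial (b # bs) f =
     (\<lambda>x. frechet_derivative (iterated_partial bs f) (at x) b)"

text \<open>\<open>frechet_derivative\<close> is only meaningful at points of differentiability; the
  following condition guarantees this at every order, and amounts to being $C^\infty$.\<close>

definition smooth :: "('a::euclidean_space \<Rightarrow> complex) \<Rightarrow> bool" where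
  "smooth f \<longleftrightarrow>
     (\<forall>bs. set bs \<subseteq> Basis \<longrightarrow> (\<forall>x. iterated_partial bs f differentiable (at x)))"

definition schwartz :: "('a::euclidean_space \<Rightarrow> complex) set" where
  "schwartz = {f. smooth f \<and>
     (\<forall>bs k. set bs \<subseteq> Basis \<longrightarrow>
        bounded (range (\<lambda>x. norm x ^ k *\<^sub>R iterated_partial bs f x)))}"

text \<open>The topological support is required to be a compact subset of \<open>S\<close>; \<open>S\<close> need not be open.\<close>

definition Cc_infinity :: "'a::euclidean_space set \<Rightarrow> ('a \<Rightarrow> complex) set" where
  "Cc_infinity S = {f. smooth f \<and>
     compact (closure {x. f x \<noteq> 0}) \<and> closure {x. f x \<noteq> 0} \<subseteq> S}"

section \<open>Fourier transform and Fourier multipliers\<close>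

definition fourier :: "('a::euclidean_space \<Rightarrow> complex) \<Rightarrow> 'a \<Rightarrow> complex" where
  "fourier f \<xi> = of_real ((2 * pi) powr (- real DIM('a) / 2)) *
     (LINT x|lborel. exp (- \<i> * of_real (\<xi> \<bullet> x)) * f x)"

definition inverse_fourier :: "('a::euclidean_space \<Rightarrow> complex) \<Rightarrow> 'a \<Rightarrow> complex" where
  "inverse_fourier g x = of_real ((2 * pi) powr (- real DIM('a) / 2)) *
     (LINT \<xi>|lborel. exp (\<i> * of_real (x \<bullet> \<xi>)) * g \<xi>)"

text \<open>The operator $m(D)$ with symbol \<open>m\<close>.\<close>

definition fourier_multiplier ::
  "('a::euclidean_space \<Rightarrow> complex) \<Rightarrow> ('a \<Rightarrow> complex) \<Rightarrow> 'a \<Rightarrow> complex" where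
  "fourier_multiplier m \<phi> = inverse_fourier (\<lambda>\<xi>. m \<xi> * fourier \<phi> \<xi>)"

section \<open>Levy measures\<close>

definition levy_measure :: "'a::euclidean_space measure \<Rightarrow> bool" where
  "levy_measure \<mu> \<longleftrightarrow> sets \<mu> = sets borel \<and> emeasure \<mu> {0} = 0 \<and>
     (\<integral>\<^sup>+ y. ennreal (min 1 ((norm y)\<^sup>2)) \<partial>\<mu>) < \<infinity>"

definition symmetric_measure :: "'a::euclidean_space measure \<Rightarrow> bool" where
  "symmetric_measure \<mu> \<longleftrightarrow> (\<forall>A\<in>sets \<mu>. emeasure \<mu> (uminus ` A) = emeasure \<mu> A)"

definition levy_symbol :: "'a::euclidean_space measure \<Rightarrow> 'a \<Rightarrow> complex" where
  "levy_symbol \<mu> \<xi> = (LINT y|\<mu>. exp (\<i> * of_real (y \<bullet> \<xi>)) - 1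
     - \<i> * of_real (y \<bullet> \<xi>) * indicator {y. norm y \<le> 1} y)"

section \<open>Scaling triples\<close>

text \<open>All three functions live on $(0,\infty)$; their values elsewhere are irrelevant.\<close>

definition scaling_triple ::
  "ereal \<Rightarrow> (real \<Rightarrow> real) \<Rightarrow> (real \<Rightarrow> real) \<Rightarrow> (real \<Rightarrow> real) \<Rightarrow> bool" where
  "scaling_triple R\<^sub>0 s s\<^sub>L s\<^sub>U \<longleftrightarrow> 1 \<le> R\<^sub>0 \<and>
     (\<forall>f\<in>{s, s\<^sub>L, s\<^sub>U}. f \<in> borel_measurable (restrict_space borel {0<..}) \<and>
        (\<forall>r>0. 0 < f r)) \<and>
     (\<forall>f\<in>{s\<^sub>L, s\<^sub>U}. mono_on {0<..} f \<and> (f \<longlongrightarrow> 0) (at_right 0) \<and>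
        filterlim f at_top at_top) \<and>
     (\<forall>r R. 0 < r \<longrightarrow> r \<le> R \<longrightarrow> ereal R < R\<^sub>0 \<longrightarrow>
        s\<^sub>L (R / r) \<le> s R / s r \<and> s R / s r \<le> s\<^sub>U (R / r))"

text \<open>For a scaling triple $s_L(1) \le 1$, so it is immaterial whether the minimum defining the
  exponent ranges over $m \ge 0$ or $m \ge 1$.\<close>

definition scaling_const :: "(real \<Rightarrow> real) \<Rightarrow> real" where
  "scaling_const s\<^sub>L = 2 ^ (LEAST m::nat. 1 < s\<^sub>L (2 ^ m))"

end

theory Submission
  imports Defs
begin

text \<open>
  For symmetric \<open>\<mu>\<close> the symbol is \<open>\<integral> (cos (y \<bullet> \<xi>) - 1) \<mu>(dy)\<close>, so with \<open>g = fourier \<phi>\<close> and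
  \<open>\<Phi> = inverse_fourier g\<close>, Fubini's theorem turns the operator applied to \<open>\<phi>\<close> into
  \<open>\<integral> (\<Phi>(x + y/r) + \<Phi>(x - y/r) - 2 \<Phi>(x)) / 2 \<mu>(dy)\<close>. The $L_1$ norm of the second difference
  of \<open>\<Phi>\<close> with step \<open>h\<close> is at most \<open>C min 1 \<bar>h\<bar>\<^sup>2\<close>, because both \<open>\<Phi>\<close> and its second derivatives,
  the inverse transforms of \<open>g\<close> and of \<open>\<xi>\<^sub>a \<xi>\<^sub>b g\<close> up to sign, are integrable. Integrating this
  bound against \<open>\<mu>\<close> and using the hypothesis on \<open>s\<close> gives the claim. Only \<open>\<Phi>\<close> occurs, so the
  inversion formula \<open>\<Phi> = \<phi>\<close> is never needed.
\<close>

section \<open>Smooth functions of compact support\<close>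

lemma smooth_differentiable: "smooth f \<Longrightarrow> f differentiable (at x)"
  unfolding smooth_def by (metis empty_set empty_subsetI iterated_partial.simps(1))

text \<open>Reduces smoothness to first-order differentiability: since partial differentiation
  preserves \<open>P\<close>, induction on the list of directions keeps every iterated partial in
  \<open>P\<close>.\<close>

lemma smooth_coinduct:
  assumes "P f"
    and diff: "\<And>f x. P f \<Longrightarrow> f differentiable (at x)"
    and partial: "\<And>f b. P f \<Longrightarrow> b \<in> Basis \<Longrightarrow> P (\<lambda>x. frechet_derivative f (at x) b)"
  shows "smooth f"
proof -
  have "P (iterated_partial bs f)" if "set bs \<subseteq> Basis" for bs
    using that by (induction bs) (auto intro: assms)
  then show ?thesis
    unfolding smooth_def using diff by blast
qed

lemma iterated_partial_append:
  "iterated_partial (bs @ cs) f = iterated_partial bs (iterated_partial cs f)"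
  by (induction bs) auto

lemma smooth_partial:
  assumes "smooth f" "b \<in> Basis"
  shows "smooth (\<lambda>x. frechet_derivative f (at x) b)"
proof -
  \<comment> \<open>The last entry of the list is differentiated first, so one initial derivative
    appends \<open>b\<close> at the end.\<close>
  have "iterated_partial bs (\<lambda>x. frechet_derivative f (at x) b) = iterated_partial (bs @ [b]) f" for bs
    by (simp add: iterated_partial_append)
  then show ?thesis
    using assms unfolding smooth_def by simp
qed

lemma smooth_const: "smooth (\<lambda>x. c)"
proof (rule smooth_coinduct[where P = "\<lambda>f. \<exists>c. f = (\<lambda>x. c)"])
qed auto

text \<open>The Leibniz rule leads from products to sums of products, so closure of the smooth functions
  under either operation is obtained by coinduction on the algebra they generate.\<close>

inductive smooth_combination :: "('a::euclidean_space \<Rightarrow> complex) \<Rightarrow> bool" where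
  smooth: "smooth f \<Longrightarrow> smooth_combination f"
| add: "smooth_combination f \<Longrightarrow> smooth_combination g \<Longrightarrow> smooth_combination (\<lambda>x. f x + g x)"
| mult: "smooth_combination f \<Longrightarrow> smooth_combination g \<Longrightarrow> smooth_combination (\<lambda>x. f x * g x)"

lemma frechet_derivative_add:
  assumes "f differentiable (at x)" "g differentiable (at x)"
  shows "frechet_derivative (\<lambda>x. f x + g x) (at x) =
           (\<lambda>h. frechet_derivative f (at x) h + frechet_derivative g (at x) h)"
  using has_derivative_add[of f _ "at x" g] assms frechet_derivative_at
  unfolding frechet_derivative_works by metis

lemma frechet_derivative_mult:
  fixes f g :: "'a::real_normed_vector \<Rightarrow> 'b::real_normed_algebra"
  assumes "f differentiable (at x)" "g differentiable (at x)"
  shows "frechet_derivative (\<lambda>x. f x * g x) (at x) =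
           (\<lambda>h. f x * frechet_derivative g (at x) h + frechet_derivative f (at x) h * g x)"
  using has_derivative_mult[of f _ x UNIV g] assms frechet_derivative_at
  unfolding frechet_derivative_works by metis

lemma smooth_combination_imp_smooth:
  assumes "smooth_combination f"
  shows "smooth f"
proof -
  \<comment> \<open>Both conjuncts go through one induction: the sum and product rules require
    differentiable components, and their results stay in the generated algebra.\<close>
  have "(\<forall>x. f differentiable (at x)) \<and>
        (\<forall>b\<in>Basis. smooth_combination (\<lambda>x. frechet_derivative f (at x) b))"
    if "smooth_combination f" for f :: "'a \<Rightarrow> complex"
    using that
  proof induction
    case (smooth f)
    then show ?case
      by (simp add: smooth_differentiable smooth_partial smooth_combination.smooth)
  next
    case (add f g)
    then show ?case
      by (simp add: frechet_derivative_add smooth_combination.add)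
  next
    case (mult f g)
    then show ?case
      by (simp add: frechet_derivative_mult smooth_combination.add smooth_combination.mult)
  qed
  then show ?thesis
    using assms by (auto intro: smooth_coinduct[where P = smooth_combination])
qed

lemma smooth_add: "smooth f \<Longrightarrow> smooth g \<Longrightarrow> smooth (\<lambda>x. f x + g x)"
  and smooth_mult: "smooth f \<Longrightarrow> smooth g \<Longrightarrow> smooth (\<lambda>x. f x * g x)"
  by (simp_all add: smooth_combination_imp_smooth smooth_combination.intros)

section \<open>Smoothness of linear forms and of plane waves\<close>

lemma frechet_derivative_inner_left:
  "frechet_derivative (\<lambda>x. complex_of_real (x \<bullet> b)) (at x) = (\<lambda>h. of_real (h \<bullet> b))"
  by (rule frechet_derivative_at[symmetric]) (auto intro!: derivative_eq_intros)

lemma smooth_inner_left: "smooth (\<lambda>x. of_real (x \<bullet> b))"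
\<comment> \<open>The partials of a linear form are constants and those of constants vanish, so
  adding the constants closes the invariant.\<close>
proof (rule smooth_coinduct[where P = "\<lambda>f. f = (\<lambda>x. of_real (x \<bullet> b)) \<or> (\<exists>c. f = (\<lambda>x. c))"])
  fix f :: "'a \<Rightarrow> complex" and x
  assume "f = (\<lambda>x. of_real (x \<bullet> b)) \<or> (\<exists>c. f = (\<lambda>x. c))"
  moreover have "(\<lambda>x. complex_of_real (x \<bullet> b)) differentiable (at x)"
    by (auto simp: differentiable_def intro!: derivative_eq_intros)
  ultimately show "f differentiable (at x)"
    by auto
qed (auto simp: frechet_derivative_inner_left)

lemma has_derivative_iexp_inner:
  "((\<lambda>y. exp (\<i> * of_real (x \<bullet> y))) has_derivative
     (\<lambda>h. \<i> * of_real (x \<bullet> h) * exp (\<i> * of_real (x \<bullet> y)))) (at y)"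
proof -
  have "((\<lambda>y. \<i> * complex_of_real (x \<bullet> y)) has_derivative (\<lambda>h. \<i> * of_real (x \<bullet> h))) (at y)"
    by (auto intro!: derivative_eq_intros)
  from has_derivative_compose[OF this DERIV_exp[unfolded has_field_derivative_def]]
  show ?thesis
    by (simp add: mult.commute)
qed

lemmas frechet_derivative_iexp_inner = frechet_derivative_at[OF has_derivative_iexp_inner, symmetric]

lemma smooth_iexp_inner: "smooth (\<lambda>y. exp (\<i> * of_real (x \<bullet> y)))"
\<comment> \<open>The invariant admits a factor \<open>c\<close> because each derivative in
  direction \<open>b\<close> only multiplies it by
  \<open>\<i> * of_real (x \<bullet> b)\<close>.\<close>
proof (rule smooth_coinduct[where P = "\<lambda>f. \<exists>c. f = (\<lambda>y. c * exp (\<i> * of_real (x \<bullet> y)))"])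
  fix f :: "'a \<Rightarrow> complex" and y
  assume "\<exists>c. f = (\<lambda>y. c * exp (\<i> * of_real (x \<bullet> y)))"
  then show "f differentiable (at y)"
    using has_derivative_mult[OF has_derivative_const has_derivative_iexp_inner[of x y]]
    by (auto simp: differentiable_def)
next
  fix f :: "'a \<Rightarrow> complex" and b
  assume "\<exists>c. f = (\<lambda>y. c * exp (\<i> * of_real (x \<bullet> y)))"
  then obtain c where "f = (\<lambda>y. c * exp (\<i> * of_real (x \<bullet> y)))"
    by blast
  moreover have "(\<lambda>y. exp (\<i> * of_real (x \<bullet> y))) differentiable (at y)" for y
    using has_derivative_iexp_inner[of x y] by (auto simp: differentiable_def)
  ultimately show "\<exists>c. (\<lambda>y. frechet_derivative f (at y) b) = (\<lambda>y. c * exp (\<i> * of_real (x \<bullet> y)))"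
    by (intro exI[of _ "c * \<i> * of_real (x \<bullet> b)"])
      (simp add: frechet_derivative_mult frechet_derivative_iexp_inner mult_ac)
qed (auto intro: exI[of _ 1])

section \<open>Algebra, derivatives and integrability of compactly supported smooth
  functions\<close>

lemma Cc_infinity_UNIV_iff: "f \<in> Cc_infinity UNIV \<longleftrightarrow> smooth f \<and> bounded {x. f x \<noteq> 0}"
  \<comment> \<open>In a Euclidean space the closure of a set is compact exactly when the set is
    bounded.\<close>
  by (simp add: Cc_infinity_def compact_closure)

lemma Cc_infinity_add:
  assumes "f \<in> Cc_infinity UNIV" "g \<in> Cc_infinity UNIV"
  shows "(\<lambda>x. f x + g x) \<in> Cc_infinity UNIV"
proof -
  have "bounded ({x. f x \<noteq> 0} \<union> {x. g x \<noteq> 0})"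
    using assms by (simp add: Cc_infinity_UNIV_iff)
  then have "bounded {x. f x + g x \<noteq> 0}"
    by (rule bounded_subset) auto
  then show ?thesis
    using assms by (simp add: Cc_infinity_UNIV_iff smooth_add)
qed

lemma Cc_infinity_mult:
  assumes "smooth f" "g \<in> Cc_infinity UNIV"
  shows "(\<lambda>x. f x * g x) \<in> Cc_infinity UNIV"
proof -
  have "bounded {x. g x \<noteq> 0}"
    using assms by (simp add: Cc_infinity_UNIV_iff)
  then have "bounded {x. f x * g x \<noteq> 0}"
    by (rule bounded_subset) auto
  then show ?thesis
    using assms by (simp add: Cc_infinity_UNIV_iff smooth_mult)
qed

text \<open>Differentiation does not enlarge the support: on the open complement of the closed
  support \<open>f\<close> vanishes identically, hence so does its derivative.\<close>

lemma Cc_infinity_partial: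
  assumes "f \<in> Cc_infinity UNIV" "b \<in> Basis"
  shows "(\<lambda>x. frechet_derivative f (at x) b) \<in> Cc_infinity UNIV"
proof -
  have "frechet_derivative f (at x) b = 0" if "x \<notin> closure {x. f x \<noteq> 0}" for x
  proof -
    have "((\<lambda>x. 0) has_derivative (\<lambda>h. 0)) (at x)"
      by simp
    then have "(f has_derivative (\<lambda>h. 0)) (at x)"
      by (rule has_derivative_transform_within_open[where s = "- closure {x. f x \<noteq> 0}"])
        (use that closure_subset[of "{x. f x \<noteq> 0}"] in auto)
    then show ?thesis
      by (metis frechet_derivative_at)
  qed
  then have "{x. frechet_derivative f (at x) b \<noteq> 0} \<subseteq> closure {x. f x \<noteq> 0}"
    by blast
  moreover have "bounded (closure {x. f x \<noteq> 0})"
    using assms by (auto simp: Cc_infinity_def dest: compact_imp_bounded)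
  ultimately show ?thesis
    using assms by (auto simp: Cc_infinity_UNIV_iff smooth_partial intro: bounded_subset)
qed

lemma Cc_infinity_continuous:
  "f \<in> Cc_infinity UNIV \<Longrightarrow> continuous_on S f"
  by (auto simp: Cc_infinity_UNIV_iff intro!: continuous_at_imp_continuous_on
      dest!: smooth_differentiable intro: differentiable_imp_continuous_within)

lemma Cc_infinity_borel_measurable [measurable_dest]:
  "f \<in> Cc_infinity UNIV \<Longrightarrow> f \<in> borel_measurable borel"
  by (intro borel_measurable_continuous_onI Cc_infinity_continuous)

lemma Cc_infinity_integrable:
  assumes "f \<in> Cc_infinity UNIV"
  shows "integrable lborel f"
proof -
  have "integrable lborel (\<lambda>x. indicator (closure {x. f x \<noteq> 0}) x *\<^sub>R f x)"
    using assms by (intro borel_integrable_compact Cc_infinity_continuous) (auto simp: Cc_infinity_def)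
  moreover have "indicator (closure {x. f x \<noteq> 0}) x *\<^sub>R f x = f x" for x
    using closure_subset[of "{x. f x \<noteq> 0}"] by (auto simp: indicator_def)
  ultimately show ?thesis
    by simp
qed

section \<open>Translation invariance and integrals of derivatives\<close>

lemma lborel_has_bochner_integral_translate:
  fixes f :: "'a::euclidean_space \<Rightarrow> 'b::{banach, second_countable_topology}"
  assumes "integrable lborel f"
  shows "has_bochner_integral lborel (\<lambda>x. f (x + c)) (LINT x|lborel. f x)"
proof -
  have [measurable]: "f \<in> borel_measurable borel"
    using borel_measurable_integrable[OF assms] by simp
  \<comment> \<open>Lebesgue measure is its own image under \<open>(+) c\<close>, which transfers
    integrability and the value of the integral together.\<close>
  have "integrable (distr lborel borel ((+) c)) f"
    using assms by (simp add: lborel_distr_plus)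
  moreover have "(LINT x|lborel. f x) = (LINT x|distr lborel borel ((+) c). f x)"
    by (simp add: lborel_distr_plus)
  ultimately show ?thesis
    by (simp add: has_bochner_integral_iff integrable_distr_eq integral_distr add.commute)
qed

lemma lborel_nn_integral_translate:
  fixes f :: "'a::euclidean_space \<Rightarrow> ennreal"
  assumes [measurable]: "f \<in> borel_measurable borel"
  shows "(\<integral>\<^sup>+ x. f (x + c) \<partial>lborel) = (\<integral>\<^sup>+ x. f x \<partial>lborel)"
proof -
  have "(\<integral>\<^sup>+ x. f x \<partial>lborel) = (\<integral>\<^sup>+ x. f x \<partial>distr lborel borel ((+) c))"
    by (simp add: lborel_distr_plus)
  also have "\<dots> = (\<integral>\<^sup>+ x. f (x + c) \<partial>lborel)"
    by (subst nn_integral_distr) (auto simp: add.commute)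
  finally show ?thesis
    by simp
qed

text \<open>By translation invariance the difference quotients have integral \<open>0\<close>; pass to the limit by
  dominated convergence.\<close>

lemma integral_partial_eq_0:
  assumes f: "f \<in> Cc_infinity UNIV" and b: "b \<in> Basis"
  shows "(LINT x|lborel. frechet_derivative f (at x) b) = 0"
proof -
  define f' where "f' = (\<lambda>x. frechet_derivative f (at x) b)"
  \<comment> \<open>Forward difference quotient with step 1/(n+1); \<open>Suc n\<close> keeps the
    step defined, nonzero and at most 1, as the support estimate below requires.\<close>
  define D where "D = (\<lambda>n x. (f (x + inverse (real (Suc n)) *\<^sub>R b) - f x) /\<^sub>R inverse (real (Suc n)))"
  have f': "f' \<in> Cc_infinity UNIV"
    unfolding f'_def using assms by (rule Cc_infinity_partial)
  note [measurable] = Cc_infinity_borel_measurable[OF f] Cc_infinity_borel_measurable[OF f']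
  have deriv: "((\<lambda>t. f (x + t *\<^sub>R b)) has_vector_derivative f' (x + t *\<^sub>R b)) (at t)" for x t
  proof -
    have "f differentiable at (x + t *\<^sub>R b)"
      using f by (simp add: Cc_infinity_UNIV_iff smooth_differentiable)
    then have "(f has_derivative frechet_derivative f (at (x + t *\<^sub>R b))) (at (x + t *\<^sub>R b))"
      by (simp add: frechet_derivative_works)
    moreover have "((\<lambda>t. x + t *\<^sub>R b) has_derivative (\<lambda>t. t *\<^sub>R b)) (at t)"
      by (auto intro!: derivative_eq_intros)
    ultimately have "((\<lambda>t. f (x + t *\<^sub>R b)) has_derivative
        (\<lambda>s. frechet_derivative f (at (x + t *\<^sub>R b)) (s *\<^sub>R b))) (at t)"
      using has_derivative_compose by blast
    moreover have "linear (frechet_derivative f (at (x + t *\<^sub>R b)))"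
      using \<open>f differentiable _\<close> by (rule linear_frechet_derivative)
    ultimately show ?thesis
      by (simp add: has_vector_derivative_def f'_def linear_scale)
  qed
  obtain R where R: "norm x \<le> R" if "f x \<noteq> 0" for x
    using f by (auto simp: Cc_infinity_UNIV_iff bounded_iff)
  have "bounded (f' ` closure {x. f' x \<noteq> 0})"
    using f' by (intro compact_imp_bounded compact_continuous_image Cc_infinity_continuous)
      (auto simp: Cc_infinity_def)
  then obtain B0 where B0: "norm (f' x) \<le> B0" if "x \<in> closure {x. f' x \<noteq> 0}" for x
    by (auto simp: bounded_iff)
  \<comment> \<open>If \<open>f'\<close> vanishes identically, its support is empty and
    \<open>B0\<close> may be negative. The maximum with 0 makes the bound valid at every
    point.\<close>
  define B where "B = max B0 0"
  have B: "norm (f' x) \<le> B" for x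
    using B0[of x] closure_subset[of "{x. f' x \<noteq> 0}"]
    by (cases "f' x = 0") (auto simp: B_def)
  have "0 \<le> B"
    by (simp add: B_def)
  have lim: "(\<lambda>n. D n x) \<longlonglongrightarrow> f' x" for x
  proof -
    have "((\<lambda>t. norm (f (x + t *\<^sub>R b) - f x - t *\<^sub>R f' x) / norm t) \<longlongrightarrow> 0) (at 0)"
      using deriv[of x 0] by (simp add: has_vector_derivative_def has_derivative_at)
    moreover have "filterlim (\<lambda>n. inverse (real (Suc n))) (at 0) sequentially"
      using LIMSEQ_inverse_real_of_nat by (auto simp: filterlim_at)
    ultimately have "(\<lambda>n. norm (f (x + inverse (real (Suc n)) *\<^sub>R b) - f x - inverse (real (Suc n)) *\<^sub>R f' x)
        / norm (inverse (real (Suc n)))) \<longlonglongrightarrow> 0"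
      by (rule filterlim_compose)
    moreover have "norm (f (x + t *\<^sub>R b) - f x - t *\<^sub>R f' x) / norm t
        = norm ((f (x + t *\<^sub>R b) - f x) /\<^sub>R t - f' x)" if "t \<noteq> 0" for t
    proof -
      have "f (x + t *\<^sub>R b) - f x - t *\<^sub>R f' x = t *\<^sub>R ((f (x + t *\<^sub>R b) - f x) /\<^sub>R t - f' x)"
        using that by (simp add: scaleR_diff_right)
      then show ?thesis
        using that by (simp del: scaleR_diff_right)
    qed
    from this[of "inverse (real (Suc n))" for n]
    have "norm (f (x + inverse (real (Suc n)) *\<^sub>R b) - f x - inverse (real (Suc n)) *\<^sub>R f' x)
        / norm (inverse (real (Suc n))) = norm (D n x - f' x)" for n
      unfolding D_def by simp
    ultimately have "(\<lambda>n. norm (D n x - f' x)) \<longlonglongrightarrow> 0"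
      by (simp only:)
    then show ?thesis
      by (simp add: LIM_zero_iff tendsto_norm_zero_iff)
  qed
  \<comment> \<open>Inside the ball the mean value inequality along the segment in direction
    \<open>b\<close> bounds the quotient. Outside it, both \<open>x\<close> and the shifted point
    have norm above \<open>R\<close>, so the quotient is 0.\<close>
  have bound: "norm (D n x) \<le> B * indicator (cball 0 (R + 1)) x" for n x
  proof (cases "norm x \<le> R + 1")
    case True
    have "norm (f (x + inverse (real (Suc n)) *\<^sub>R b) - f (x + 0 *\<^sub>R b)) \<le> B * norm (inverse (real (Suc n)) - 0)"
      by (rule differentiable_bound[where S = UNIV and f' = "\<lambda>t s. s *\<^sub>R f' (x + t *\<^sub>R b)" and f = "\<lambda>t. f (x + t *\<^sub>R b)"])
       (use deriv B in \<open>auto simp: has_vector_derivative_def onorm_scaleR_left onorm_id bounded_linear_ident\<close>)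
    moreover have "norm (D n x) = real (Suc n) * norm (f (x + inverse (real (Suc n)) *\<^sub>R b) - f x)"
      by (simp add: D_def del: of_nat_Suc)
    ultimately show ?thesis
      using True by (simp add: divide_simps mult.commute del: of_nat_Suc)
  next
    case False
    have "norm (x + inverse (real (Suc n)) *\<^sub>R b) \<ge> norm x - norm (inverse (real (Suc n)) *\<^sub>R b)"
      by (rule norm_diff_ineq) 
    moreover have "norm (inverse (real (Suc n)) *\<^sub>R b) \<le> 1"
      using b by (simp add: divide_simps)
    ultimately have "f (x + inverse (real (Suc n)) *\<^sub>R b) = 0" "f x = 0"
      using False R[of x] R[of "x + inverse (real (Suc n)) *\<^sub>R b"] by force+
    then show ?thesis
      using \<open>0 \<le> B\<close> by (simp add: D_def)
  qed
  have "(\<lambda>n. LINT x|lborel. D n x) \<longlonglongrightarrow> (LINT x|lborel. f' x)"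
  proof (rule integral_dominated_convergence)
    show "integrable lborel (\<lambda>x::'a. B * indicator (cball 0 (R + 1)) x :: real)"
      using emeasure_bounded_finite[of "cball (0::'a) (R + 1)"]
      by (intro integrable_mult_right integrable_real_indicator) auto
  qed (use lim bound in \<open>auto simp: D_def\<close>)
  moreover have "(LINT x|lborel. D n x) = 0" for n
    using lborel_has_bochner_integral_translate[OF Cc_infinity_integrable[OF f], of "inverse (real (Suc n)) *\<^sub>R b"]
      Cc_infinity_integrable[OF f]
    by (simp add: D_def has_bochner_integral_iff)
  ultimately show ?thesis
    by (simp add: f'_def LIMSEQ_const_iff)
qed

section \<open>An integrable weight on Euclidean space\<close>

lemma nn_integral_inverse_1_plus_square_less_top:
  "(\<integral>\<^sup>+ (x::real). ennreal (inverse (1 + x\<^sup>2)) \<partial>lborel) < \<infinity>"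
proof -
  let ?f = "\<lambda>x::real. ennreal (inverse (1 + x\<^sup>2))"
  \<comment> \<open>The antiderivative is \<open>arctan\<close>, which tends to pi/2 at infinity;
    reflection then treats the negative half-line.\<close>
  have half: "(\<integral>\<^sup>+ x. ?f x * indicator {0..} x \<partial>lborel) = ennreal (pi / 2 - arctan 0)"
  proof (rule nn_integral_FTC_atLeast)
    show "(arctan has_real_derivative inverse (1 + x\<^sup>2)) (at x)" for x
      by (rule DERIV_arctan)
  qed (auto simp: tendsto_arctan_at_top)
  have reflect: "(\<integral>\<^sup>+ x. ?f (- x) * indicator {0..} (- x) \<partial>lborel) = (\<integral>\<^sup>+ x. ?f x * indicator {0..} x \<partial>lborel)"
    by (subst (2) nn_integral_real_affine[where c = "-1" and t = 0]) auto
  \<comment> \<open>The two closed half-lines share the origin, where \<open>?f\<close> is counted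
    twice, so the pointwise comparison is only an inequality.\<close>
  have "(\<integral>\<^sup>+ x. ?f x \<partial>lborel) \<le> (\<integral>\<^sup>+ x. ?f x * indicator {0..} x + ?f (- x) * indicator {0..} (- x) \<partial>lborel)"
    by (intro nn_integral_mono) (auto simp: indicator_def)
  also have "\<dots> = (\<integral>\<^sup>+ x. ?f x * indicator {0..} x \<partial>lborel) + (\<integral>\<^sup>+ x. ?f (- x) * indicator {0..} (- x) \<partial>lborel)"
    by (rule nn_integral_add) auto
  also have "\<dots> < \<infinity>"
    unfolding reflect half by simp
  finally show ?thesis .
qed

text \<open>Lebesgue measure factors over the coordinates, so the integral is a power of the
  one-dimensional one.\<close>

lemma nn_integral_prod_inverse_1_plus_square_less_top:
  "(\<integral>\<^sup>+ (x::'a::euclidean_space). ennreal (\<Prod>b\<in>Basis. inverse (1 + (x \<bullet> b)\<^sup>2)) \<partial>lborel) < \<infinity>"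
proof -
  have "(\<integral>\<^sup>+ (x::'a). ennreal (\<Prod>b\<in>Basis. inverse (1 + (x \<bullet> b)\<^sup>2)) \<partial>lborel)
      = (\<integral>\<^sup>+ (x::'a). (\<Prod>b\<in>Basis. ennreal (inverse (1 + (x \<bullet> b)\<^sup>2))) \<partial>lborel)"
    by (simp add: prod_ennreal)
  also have "\<dots> = (\<Prod>b\<in>(Basis :: 'a set). \<integral>\<^sup>+ x. ennreal (inverse (1 + x\<^sup>2)) \<partial>lborel)"
    by (rule nn_integral_lborel_prod) auto
  also have "\<dots> < \<infinity>"
    using nn_integral_inverse_1_plus_square_less_top by (simp add: power_less_top_ennreal)
  finally show ?thesis .
qed

section \<open>Decay of the inverse Fourier transform\<close>

lemma borel_measurable_inverse_fourier:
  assumes [measurable]: "f \<in> borel_measurable borel"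
  shows "inverse_fourier f \<in> borel_measurable borel"
  unfolding inverse_fourier_def by measurable

lemma integrable_iexp_mult:
  assumes "integrable M f" and [measurable]: "u \<in> borel_measurable M"
  shows "integrable M (\<lambda>x. exp (\<i> * of_real (u x)) * f x)"
proof (rule Bochner_Integration.integrable_bound[OF assms(1)])
  have [measurable]: "f \<in> borel_measurable M"
    using assms(1) by simp
  show "(\<lambda>x. exp (\<i> * of_real (u x)) * f x) \<in> borel_measurable M"
    by measurable
qed (simp add: norm_mult)

lemma inverse_fourier_add:
  assumes "integrable lborel f" "integrable lborel g"
  shows "inverse_fourier (\<lambda>\<xi>. f \<xi> + g \<xi>) x = inverse_fourier f x + inverse_fourier g x"
  unfolding inverse_fourier_def distrib_left
  by (subst Bochner_Integration.integral_add) (auto intro!: integrable_iexp_mult assms simp: distrib_left)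

lemma inverse_fourier_cmult:
  "inverse_fourier (\<lambda>\<xi>. c * f \<xi>) x = c * inverse_fourier f x"
  unfolding inverse_fourier_def by (simp add: mult.left_commute[of _ c])

lemma inverse_fourier_sum:
  assumes "\<And>i. i \<in> I \<Longrightarrow> integrable lborel (f i)"
  shows "inverse_fourier (\<lambda>\<xi>. \<Sum>i\<in>I. f i \<xi>) x = (\<Sum>i\<in>I. inverse_fourier (f i) x)"
  unfolding inverse_fourier_def sum_distrib_left
  by (subst Bochner_Integration.integral_sum) (auto intro!: integrable_iexp_mult assms simp: sum_distrib_left)

text \<open>The exponential has modulus one. Should its product with \<open>f\<close> fail to be
  integrable, the integral on the left has the default value 0 and the bound persists.\<close>

lemma norm_inverse_fourier_le:
  fixes f :: "'a::euclidean_space \<Rightarrow> complex"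
  shows "norm (inverse_fourier f x) \<le> (2 * pi) powr (- real DIM('a) / 2) * (LINT \<xi>|lborel. norm (f \<xi>))"
  unfolding inverse_fourier_def norm_mult
  using integral_norm_bound[of lborel "\<lambda>\<xi>. exp (\<i> * of_real (x \<bullet> \<xi>)) * f \<xi>"]
  by (simp add: norm_mult mult_left_mono)

text \<open>Integration by parts: the product of \<open>f\<close> with the plane wave has compact
  support, so the integral of its partial derivative is 0, and the product rule splits that integral
  into two.\<close>

lemma inverse_fourier_partial:
  assumes "f \<in> Cc_infinity UNIV" "b \<in> Basis"
  shows "inverse_fourier (\<lambda>\<xi>. frechet_derivative f (at \<xi>) b) x = - \<i> * of_real (x \<bullet> b) * inverse_fourier f x"
proof -
  let ?e = "\<lambda>\<xi>. exp (\<i> * of_real (x \<bullet> \<xi>))"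
  have "(\<lambda>\<xi>. ?e \<xi> * f \<xi>) \<in> Cc_infinity UNIV"
    using assms(1) by (intro Cc_infinity_mult smooth_iexp_inner)
  then have "(LINT \<xi>|lborel. frechet_derivative (\<lambda>\<xi>. ?e \<xi> * f \<xi>) (at \<xi>) b) = 0"
    using assms(2) by (rule integral_partial_eq_0)
  moreover have "frechet_derivative (\<lambda>\<xi>. ?e \<xi> * f \<xi>) (at \<xi>) b
      = ?e \<xi> * frechet_derivative f (at \<xi>) b + \<i> * of_real (x \<bullet> b) * (?e \<xi> * f \<xi>)" for \<xi>
    using assms(1)
    by (subst frechet_derivative_mult)
      (auto simp: frechet_derivative_iexp_inner Cc_infinity_UNIV_iff smooth_differentiable smooth_iexp_inner)
  ultimately have "(LINT \<xi>|lborel. ?e \<xi> * frechet_derivative f (at \<xi>) b)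
      + \<i> * of_real (x \<bullet> b) * (LINT \<xi>|lborel. ?e \<xi> * f \<xi>) = 0"
    using Cc_infinity_integrable[OF Cc_infinity_partial[OF assms]] Cc_infinity_integrable[OF assms(1)]
    by (simp add: integrable_iexp_mult)
  then have "(LINT \<xi>|lborel. ?e \<xi> * frechet_derivative f (at \<xi>) b)
      = - (\<i> * of_real (x \<bullet> b) * (LINT \<xi>|lborel. ?e \<xi> * f \<xi>))"
    by (simp only: eq_neg_iff_add_eq_0)
  then show ?thesis
    unfolding inverse_fourier_def by (simp add: mult_ac)
qed

text \<open>The weight corresponds to the operator $1 - \partial_b^2$ on the Fourier side.\<close>

lemma Cc_infinity_inverse_fourier_weight:
  assumes "f \<in> Cc_infinity UNIV" "b \<in> Basis"
  shows "\<exists>h\<in>Cc_infinity UNIV. \<forall>x. of_real (1 + (x \<bullet> b)\<^sup>2) * inverse_fourier f x = inverse_fourier h x"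
proof -
  define f' where "f' = (\<lambda>\<xi>. frechet_derivative f (at \<xi>) b)"
  define f'' where "f'' = (\<lambda>\<xi>. frechet_derivative f' (at \<xi>) b)"
  have f': "f' \<in> Cc_infinity UNIV" and f'': "f'' \<in> Cc_infinity UNIV"
    unfolding f'_def f''_def using assms by (auto intro!: Cc_infinity_partial)
  \<comment> \<open>The negation is written as a factor \<open>- 1\<close>, matching the form of
    \<open>Cc_infinity_mult\<close> and \<open>inverse_fourier_cmult\<close>.\<close>
  then have mf'': "(\<lambda>\<xi>. - 1 * f'' \<xi>) \<in> Cc_infinity UNIV"
    by (intro Cc_infinity_mult smooth_const)
  \<comment> \<open>Two integrations by parts contribute the square of
    \<open>- \<i> * of_real (x \<bullet> b)\<close>.\<close>
  have "inverse_fourier f'' x = - of_real ((x \<bullet> b)\<^sup>2) * inverse_fourier f x" for x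
    unfolding f''_def inverse_fourier_partial[OF f' assms(2)]
    unfolding f'_def inverse_fourier_partial[OF assms]
    by (simp add: power2_eq_square mult_ac)
  moreover have "inverse_fourier (\<lambda>\<xi>. f \<xi> + - 1 * f'' \<xi>) x = inverse_fourier f x + - 1 * inverse_fourier f'' x" for x
    using assms(1) mf''
    by (subst inverse_fourier_add, blast intro: Cc_infinity_integrable, blast intro: Cc_infinity_integrable)
      (subst inverse_fourier_cmult, rule refl)
  ultimately have "of_real (1 + (x \<bullet> b)\<^sup>2) * inverse_fourier f x = inverse_fourier (\<lambda>\<xi>. f \<xi> + - 1 * f'' \<xi>) x" for x
    by (simp add: ring_distribs)
  then show ?thesis
    using Cc_infinity_add[OF assms(1) mf''] by blast
qed

text \<open>The one-coordinate weights are applied successively over the basis; each time the result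
  is again the inverse transform of a compactly supported smooth function, and the last of these is
  bounded. A product weight is chosen because its integral factors.\<close>

lemma Cc_infinity_inverse_fourier_decay:
  fixes f :: "'a::euclidean_space \<Rightarrow> complex"
  assumes "f \<in> Cc_infinity UNIV"
  obtains C where "\<And>x. norm (inverse_fourier f x) \<le> C * (\<Prod>b\<in>Basis. inverse (1 + (x \<bullet> b)\<^sup>2))"
proof -
  have "\<exists>h\<in>Cc_infinity UNIV. \<forall>x. of_real (\<Prod>b\<in>B. 1 + (x \<bullet> b)\<^sup>2) * inverse_fourier f x = inverse_fourier h x"
    if "finite B" "B \<subseteq> Basis" for B :: "'a set"
    using that
  proof (induction B)
    case empty
    then show ?case
      using assms by auto
  next
    case (insert b B)
    then obtain h where h: "h \<in> Cc_infinity UNIV"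
      "\<And>x. of_real (\<Prod>b\<in>B. 1 + (x \<bullet> b)\<^sup>2) * inverse_fourier f x = inverse_fourier h x"
      by auto
    with insert.prems Cc_infinity_inverse_fourier_weight[of h b] obtain h' where
      "h' \<in> Cc_infinity UNIV" "\<And>x. of_real (1 + (x \<bullet> b)\<^sup>2) * inverse_fourier h x = inverse_fourier h' x"
      by auto
    with h(2) show ?case
      using insert.hyps by (intro bexI[of _ h']) (simp_all add: mult.assoc flip: h(2))
  qed
  from this[of Basis] obtain h where
    h: "\<And>x. of_real (\<Prod>b\<in>Basis. 1 + (x \<bullet> b)\<^sup>2) * inverse_fourier f x = inverse_fourier h x"
    by auto
  show ?thesis
  proof (rule that)
    fix x :: 'a
    let ?C = "(2 * pi) powr (- real DIM('a) / 2) * (LINT \<xi>|lborel. norm (h \<xi>))"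
    let ?P = "\<Prod>b\<in>Basis. 1 + (x \<bullet> b)\<^sup>2"
    have "0 < ?P"
      by (intro prod_pos) (auto simp: add_pos_nonneg)
    then have "?P * norm (inverse_fourier f x) = norm (inverse_fourier h x)"
      unfolding h[symmetric] norm_mult norm_of_real by simp
    also have "\<dots> \<le> ?C"
      by (rule norm_inverse_fourier_le)
    finally show "norm (inverse_fourier f x) \<le> ?C * (\<Prod>b\<in>Basis. inverse (1 + (x \<bullet> b)\<^sup>2))"
      using \<open>0 < ?P\<close> unfolding prod_inversef[of "\<lambda>b. 1 + (x \<bullet> b)\<^sup>2", unfolded o_def]
      by (simp add: field_simps)
  qed
qed

lemma Cc_infinity_nn_integral_inverse_fourier:
  fixes f :: "'a::euclidean_space \<Rightarrow> complex"
  assumes "f \<in> Cc_infinity UNIV"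
  shows "(\<integral>\<^sup>+ x. norm (inverse_fourier f x) \<partial>lborel) < \<infinity>"
proof -
  obtain C where C: "\<And>x. norm (inverse_fourier f x) \<le> C * (\<Prod>b\<in>Basis. inverse (1 + (x \<bullet> b)\<^sup>2))"
    using Cc_infinity_inverse_fourier_decay[OF assms] by metis
  have "(\<integral>\<^sup>+ x. norm (inverse_fourier f x) \<partial>lborel)
      \<le> (\<integral>\<^sup>+ (x::'a). ennreal C * ennreal (\<Prod>b\<in>Basis. inverse (1 + (x \<bullet> b)\<^sup>2)) \<partial>lborel)"
    \<comment> \<open>Splitting the product in \<open>ennreal\<close> relies on the sign of the
      weight alone, so nothing need be known about the sign of \<open>C\<close>.\<close>
    using C by (intro nn_integral_mono) (simp add: ennreal_leI prod_nonneg flip: ennreal_mult'')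
  also have "\<dots> = ennreal C * (\<integral>\<^sup>+ (x::'a). ennreal (\<Prod>b\<in>Basis. inverse (1 + (x \<bullet> b)\<^sup>2)) \<partial>lborel)"
    by (rule nn_integral_cmult) measurable
  also have "\<dots> < \<infinity>"
    using nn_integral_prod_inverse_1_plus_square_less_top[where 'a = 'a] by (simp add: ennreal_mult_less_top)
  finally show ?thesis .
qed

section \<open>Integrability on products and norms of integrals\<close>

lemma (in pair_sigma_finite) integrable_bounded_by_product:
  fixes f :: "'a \<times> 'b \<Rightarrow> 'c::{banach, second_countable_topology}"
  assumes f [measurable]: "f \<in> borel_measurable (M1 \<Otimes>\<^sub>M M2)"
    and a: "integrable M1 a" and b: "integrable M2 b"
    and le: "\<And>x y. norm (f (x, y)) \<le> a x * b y"
  shows "integrable (M1 \<Otimes>\<^sub>M M2) f"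
proof -
  \<comment> \<open>The product bound supplies both hypotheses of the integrability criterion: each
    slice is dominated by a multiple of \<open>b\<close>, and the integrated norms by a multiple of
    \<open>a\<close>.\<close>
  have "integrable M2 (\<lambda>y. f (x, y))" if "x \<in> space M1" for x
  proof (rule Bochner_Integration.integrable_bound)
    show "integrable M2 (\<lambda>y. a x * b y)"
      using b by simp
    show "(\<lambda>y. f (x, y)) \<in> borel_measurable M2"
      using that by measurable
  qed (use le in \<open>auto intro: order_trans[OF _ abs_ge_self]\<close>)
  moreover have "integrable M1 (\<lambda>x. LINT y|M2. norm (f (x, y)))"
  proof (rule Bochner_Integration.integrable_bound)
    show "integrable M1 (\<lambda>x. a x * (LINT y|M2. b y))"
      using a by simp
    show "(\<lambda>x. LINT y|M2. norm (f (x, y))) \<in> borel_measurable M1"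
      by measurable
    show "AE x in M1. norm (LINT y|M2. norm (f (x, y))) \<le> norm (a x * (LINT y|M2. b y))"
    proof (rule AE_I2)
      fix x assume "x \<in> space M1"
      then have "(LINT y|M2. norm (f (x, y))) \<le> (LINT y|M2. a x * b y)"
        using b le \<open>x \<in> space M1 \<Longrightarrow> integrable M2 (\<lambda>y. f (x, y))\<close>
        by (intro integral_mono) auto
      then show "norm (LINT y|M2. norm (f (x, y))) \<le> norm (a x * (LINT y|M2. b y))"
        by simp
    qed
  qed
  ultimately show ?thesis
    by (intro Fubini_integrable[OF f] AE_I2)
qed

text \<open>In the non-integrable case the Bochner integral is 0 by convention. Norms of integrals
  can thus be estimated before integrability is known.\<close>

lemma ennreal_norm_integral_le_nn_integral:
  fixes f :: "_ \<Rightarrow> 'b::{banach, second_countable_topology}"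
  shows "ennreal (norm (integral\<^sup>L M f)) \<le> (\<integral>\<^sup>+ x. norm (f x) \<partial>M)"
  by (cases "integrable M f") (simp_all add: integral_norm_bound_ennreal not_integrable_integral_eq)

section \<open>Second differences\<close>

lemma inverse_fourier_translate:
  "inverse_fourier f (x + h) = inverse_fourier (\<lambda>\<xi>. exp (\<i> * of_real (h \<bullet> \<xi>)) * f \<xi>) x"
  unfolding inverse_fourier_def
  by (simp add: inner_add_left ring_distribs exp_add mult.assoc)

abbreviation second_difference :: "('a::euclidean_space \<Rightarrow> complex) \<Rightarrow> 'a \<Rightarrow> 'a \<Rightarrow> complex" where
  "second_difference f h x \<equiv> f (x + h) + f (x - h) - 2 * f x"

lemma iexp_add_iexp_minus: "exp (\<i> * of_real u) + exp (- \<i> * of_real u) = of_real (2 * cos u)"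
  using cos_of_real[of u, where 'a = complex] by (simp add: cos_exp_eq)

text \<open>Translations by \<open>h\<close> and \<open>- h\<close> become modulations by conjugate
  exponentials, which add up to twice a cosine.\<close>

lemma inverse_fourier_translate_add:
  assumes "integrable lborel f"
  shows "inverse_fourier f (x + h) + inverse_fourier f (x - h)
      = inverse_fourier (\<lambda>\<xi>. of_real (2 * cos (h \<bullet> \<xi>)) * f \<xi>) x"
proof -
  have "inverse_fourier f (x + h) + inverse_fourier f (x - h) = inverse_fourier f (x + h) + inverse_fourier f (x + (- h))"
    by simp
  also have "\<dots> = inverse_fourier (\<lambda>\<xi>. exp (\<i> * of_real (h \<bullet> \<xi>)) * f \<xi> + exp (\<i> * of_real ((- h) \<bullet> \<xi>)) * f \<xi>) x"
    unfolding inverse_fourier_translate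
    by (rule inverse_fourier_add[symmetric]) (use assms in \<open>auto intro!: integrable_iexp_mult simp del: inner_minus_left\<close>)
  also have "\<dots> = inverse_fourier (\<lambda>\<xi>. of_real (2 * cos (h \<bullet> \<xi>)) * f \<xi>) x"
    using iexp_add_iexp_minus[of "h \<bullet> \<xi>" for \<xi>]
    by (simp flip: distrib_right del: of_real_mult)
  finally show ?thesis .
qed

text \<open>The bridge to Levy symbols: this multiplier is twice the integrand
  \<open>cos (y \<bullet> \<xi>) - 1\<close> of a symmetric symbol, with \<open>h\<close> in place
  of \<open>y\<close>.\<close>

lemma second_difference_inverse_fourier:
  assumes [measurable]: "integrable lborel f"
  shows "second_difference (inverse_fourier f) h x
      = inverse_fourier (\<lambda>\<xi>. of_real (2 * (cos (h \<bullet> \<xi>) - 1)) * f \<xi>) x"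
proof -
  have "integrable lborel (\<lambda>\<xi>. of_real (2 * cos (h \<bullet> \<xi>)) * f \<xi>)"
    by (rule Bochner_Integration.integrable_bound[of _ "\<lambda>\<xi>. 2 * f \<xi>"])
      (auto simp: norm_mult mult_left_le_one_le assms)
  then have "inverse_fourier (\<lambda>\<xi>. of_real (2 * cos (h \<bullet> \<xi>)) * f \<xi> + - 2 * f \<xi>) x
      = inverse_fourier f (x + h) + inverse_fourier f (x - h) + - 2 * inverse_fourier f x"
    using assms by (subst inverse_fourier_add) (auto simp only: inverse_fourier_cmult inverse_fourier_translate_add integrable_mult_right)
  then show ?thesis
    by (simp add: algebra_simps)
qed

lemma cos_minus_1_integral:
  fixes u :: real
  shows "has_bochner_integral lborel
    (\<lambda>t. indicator {0..1} t * ((1 - t) * u\<^sup>2 * cos (t * u))) (1 - cos u)"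
proof -
  \<comment> \<open>An antiderivative found by integration by parts: upon differentiation the sine
    terms cancel. Its values at 1 and 0 are \<open>- cos u\<close> and -1.\<close>
  let ?F = "\<lambda>t. (1 - t) * u * sin (t * u) - cos (t * u)"
  have "has_bochner_integral lborel (\<lambda>t. indicator {0..1} t *\<^sub>R ((1 - t) * u\<^sup>2 * cos (t * u))) (?F 1 - ?F 0)"
  proof (rule has_bochner_integral_FTC_Icc)
    show "(?F has_vector_derivative ((1 - t) * u\<^sup>2 * cos (t * u))) (at t within {0..1})" for t
      unfolding has_real_derivative_iff_has_vector_derivative[symmetric]
      by (auto intro!: derivative_eq_intros simp: power2_eq_square algebra_simps)
  qed (auto intro!: continuous_intros)
  then show ?thesis
    by simp
qed

text \<open>Taylor's formula with integral remainder; \<open>- F\<close> is the second derivative of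
  \<open>inverse_fourier f\<close> in direction \<open>h\<close>.\<close>

lemma second_difference_inverse_fourier_integral:
  fixes f :: "'a::euclidean_space \<Rightarrow> complex" and h :: 'a
  assumes f: "f \<in> Cc_infinity UNIV"
  defines "F \<equiv> inverse_fourier (\<lambda>\<xi>. of_real ((h \<bullet> \<xi>)\<^sup>2) * f \<xi>)"
  shows "second_difference (inverse_fourier f) h x =
    - (LINT t|lborel. of_real (indicator {0..1} t * (1 - t)) * (F (x + t *\<^sub>R h) + F (x - t *\<^sub>R h)))"
proof -
  let ?c = "complex_of_real ((2 * pi) powr (- real DIM('a) / 2))"
  define H where "H = (\<lambda>\<xi>. of_real ((h \<bullet> \<xi>)\<^sup>2) * f \<xi>)"
  \<comment> \<open>The integrand in both variables. Integration over \<open>t\<close> first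
    produces the multiplier of the second difference, up to sign; integration over
    \<open>\<xi>\<close> first produces translates of \<open>F\<close>. Fubini equates the
    two.\<close>
  define k where "k = (\<lambda>t \<xi>. exp (\<i> * of_real (x \<bullet> \<xi>)) *
    (of_real (indicator {0..1} t * (1 - t)) * (of_real (2 * cos (t * (h \<bullet> \<xi>))) * H \<xi>)))"
  have "smooth (\<lambda>\<xi>. of_real (\<xi> \<bullet> h) * of_real (\<xi> \<bullet> h))"
    by (intro smooth_mult smooth_inner_left)
  from Cc_infinity_mult[OF this f] have H: "H \<in> Cc_infinity UNIV"
    by (simp add: H_def power2_eq_square inner_commute)
  note [measurable] = Cc_infinity_borel_measurable[OF f] Cc_infinity_borel_measurable[OF H]
  have k: "integrable (lborel \<Otimes>\<^sub>M lborel) (case_prod k)"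
  proof (rule lborel_pair.integrable_bounded_by_product)
    show "case_prod k \<in> borel_measurable (lborel \<Otimes>\<^sub>M lborel)"
      unfolding k_def by measurable
    show "integrable lborel (indicator {0..1::real} :: real \<Rightarrow> real)"
      by simp
    show "integrable lborel (\<lambda>\<xi>. 2 * norm (H \<xi>))"
      using Cc_infinity_integrable[OF H] by simp
    fix t \<xi>
    have "norm (k t \<xi>) = \<bar>indicator {0..1} t * (1 - t)\<bar> * (2 * norm (H \<xi>) * \<bar>cos (t * (h \<bullet> \<xi>))\<bar>)"
      unfolding k_def norm_mult norm_of_real by (simp add: abs_mult)
    also have "\<dots> \<le> indicator {0..1} t * (2 * norm (H \<xi>) * 1)"
      by (intro mult_mono mult_left_mono) (auto simp: indicator_def)
    finally show "norm (case (t, \<xi>) of (t, \<xi>) \<Rightarrow> k t \<xi>) \<le> indicator {0..1} t * (2 * norm (H \<xi>))"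
      by simp
  qed
  have "exp (\<i> * of_real (x \<bullet> \<xi>)) * (of_real (2 * (cos (h \<bullet> \<xi>) - 1)) * f \<xi>) = - (LINT t|lborel. k t \<xi>)" for \<xi>
  proof -
    have "(LINT t|lborel. k t \<xi>) = (LINT t|lborel. exp (\<i> * of_real (x \<bullet> \<xi>)) * (2 * f \<xi> *
        of_real (indicator {0..1} t * ((1 - t) * (h \<bullet> \<xi>)\<^sup>2 * cos (t * (h \<bullet> \<xi>))))))"
      by (simp add: k_def H_def mult_ac)
    also have "\<dots> = exp (\<i> * of_real (x \<bullet> \<xi>)) * (2 * f \<xi> * of_real (1 - cos (h \<bullet> \<xi>)))"
      using cos_minus_1_integral[of "h \<bullet> \<xi>", THEN has_bochner_integral_integral_eq]
      by (simp only: integral_mult_right_zero integral_complex_of_real)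
    finally show ?thesis
      by (simp add: algebra_simps)
  qed
  then have "second_difference (inverse_fourier f) h x = - ?c * (LINT \<xi>|lborel. LINT t|lborel. k t \<xi>)"
    using Cc_infinity_integrable[OF f] unfolding second_difference_inverse_fourier[OF Cc_infinity_integrable[OF f]]
    by (simp add: inverse_fourier_def)
  also have "\<dots> = - (LINT t|lborel. ?c * (LINT \<xi>|lborel. k t \<xi>))"
    using lborel_pair.Fubini_integral[OF k] by simp
  also have "(\<lambda>t. ?c * (LINT \<xi>|lborel. k t \<xi>)) =
      (\<lambda>t. of_real (indicator {0..1} t * (1 - t)) * (F (x + t *\<^sub>R h) + F (x - t *\<^sub>R h)))"
  proof
    fix t :: real
    have "?c * (LINT \<xi>|lborel. k t \<xi>) = inverse_fourier (\<lambda>\<xi>. of_real (indicator {0..1} t * (1 - t)) *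
        (of_real (2 * cos (t * (h \<bullet> \<xi>))) * H \<xi>)) x"
      by (simp add: inverse_fourier_def k_def)
    also have "\<dots> = of_real (indicator {0..1} t * (1 - t)) * inverse_fourier (\<lambda>\<xi>.
        of_real (2 * cos (t * (h \<bullet> \<xi>))) * H \<xi>) x"
      by (rule inverse_fourier_cmult)
    also have "inverse_fourier (\<lambda>\<xi>. of_real (2 * cos (t * (h \<bullet> \<xi>))) * H \<xi>) x = F (x + t *\<^sub>R h) + F (x - t *\<^sub>R h)"
      using inverse_fourier_translate_add[OF Cc_infinity_integrable[OF H], of x "t *\<^sub>R h"]
      by (simp add: F_def H_def)
    finally show "?c * (LINT \<xi>|lborel. k t \<xi>) =
      of_real (indicator {0..1} t * (1 - t)) * (F (x + t *\<^sub>R h) + F (x - t *\<^sub>R h))" .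
  qed
  finally show ?thesis .
qed

text \<open>Triangle inequality and translation invariance; the coefficients 1, 1 and 2 add up to
  4.\<close>

lemma nn_integral_second_difference_le:
  fixes f :: "'a::euclidean_space \<Rightarrow> complex"
  assumes [measurable]: "f \<in> borel_measurable borel"
  shows "(\<integral>\<^sup>+ x. norm (second_difference f h x) \<partial>lborel) \<le> 4 * (\<integral>\<^sup>+ x. norm (f x) \<partial>lborel)"
proof -
  have "(\<integral>\<^sup>+ x. norm (second_difference f h x) \<partial>lborel)
      \<le> (\<integral>\<^sup>+ x. (ennreal (norm (f (x + h))) + ennreal (norm (f (x + - h)))) + 2 * ennreal (norm (f x)) \<partial>lborel)"
  proof (intro nn_integral_mono)
    fix x
    have "norm (second_difference f h x) \<le> (norm (f (x + h)) + norm (f (x + - h))) + 2 * norm (f x)"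
      using norm_triangle_ineq4[of "f (x + h) + f (x - h)" "2 * f x"] norm_triangle_ineq[of "f (x + h)" "f (x - h)"]
      by (simp add: norm_mult)
    then have "ennreal (norm (second_difference f h x))
        \<le> ennreal ((norm (f (x + h)) + norm (f (x + - h))) + 2 * norm (f x))"
      by (rule ennreal_leI)
    then show "ennreal (norm (second_difference f h x))
        \<le> (ennreal (norm (f (x + h))) + ennreal (norm (f (x + - h)))) + 2 * ennreal (norm (f x))"
      by (simp add: ennreal_mult'' del: add_uminus_conv_diff)
  qed
  also have "\<dots> = 4 * (\<integral>\<^sup>+ x. norm (f x) \<partial>lborel)"
    using lborel_nn_integral_translate[of "\<lambda>x. ennreal (norm (f x))" h]
      lborel_nn_integral_translate[of "\<lambda>x. ennreal (norm (f x))" "- h"]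
    by (simp add: nn_integral_add nn_integral_cmult flip: mult_2 distrib_right del: add_uminus_conv_diff)
  finally show ?thesis .
qed

text \<open>Long steps are handled by the triangle inequality, short ones by Taylor's formula. Each
  regime gives one constant, and \<open>C\<close> is their sum.\<close>

lemma nn_integral_second_difference_inverse_fourier_le:
  fixes f :: "'a::euclidean_space \<Rightarrow> complex"
  assumes f: "f \<in> Cc_infinity UNIV"
  obtains C :: real where "0 \<le> C"
    "\<And>h. (\<integral>\<^sup>+ x. norm (second_difference (inverse_fourier f) h x) \<partial>lborel) \<le> ennreal (C * min 1 ((norm h)\<^sup>2))"
proof -
  define F where "F = (\<lambda>h. inverse_fourier (\<lambda>\<xi>. of_real ((h \<bullet> \<xi>)\<^sup>2) * f \<xi>))"
  \<comment> \<open>For a pair of basis vectors this is, up to sign, the transform of a mixed second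
    derivative. It does not involve \<open>h\<close>, hence neither does \<open>K\<close>.\<close>
  define g where "g = (\<lambda>p \<xi>. of_real (\<xi> \<bullet> fst p) * (of_real (\<xi> \<bullet> snd p) * f \<xi>))"
  define I where "I = (\<integral>\<^sup>+ x. norm (inverse_fourier f x) \<partial>lborel)"
  define K where "K = (\<Sum>p\<in>Basis \<times> Basis. \<integral>\<^sup>+ x. norm (inverse_fourier (g p) x) \<partial>lborel)"
  note [measurable] = Cc_infinity_borel_measurable[OF f] borel_measurable_inverse_fourier
  have g: "g p \<in> Cc_infinity UNIV" for p
    unfolding g_def using f by (intro Cc_infinity_mult smooth_inner_left)
  have [measurable]: "g p \<in> borel_measurable borel" for p
    unfolding g_def by measurable
  have [measurable]: "F h \<in> borel_measurable borel" for h :: 'a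
    unfolding F_def by measurable
  have "I < \<infinity>"
    unfolding I_def using f by (rule Cc_infinity_nn_integral_inverse_fourier)
  have "K < \<infinity>"
    unfolding K_def using Cc_infinity_nn_integral_inverse_fourier[OF g] by simp
  \<comment> \<open>Expanding the square of \<open>h \<bullet> \<xi>\<close> in coordinates moves
    all dependence on \<open>h\<close> into coefficients, each at most the square of
    \<open>norm h\<close> in modulus.\<close>
  have F_le: "(\<integral>\<^sup>+ x. norm (F h x) \<partial>lborel) \<le> ennreal ((norm h)\<^sup>2) * K" for h :: 'a
  proof -
    have "norm (F h x) \<le> (\<Sum>p\<in>Basis \<times> Basis. (norm h)\<^sup>2 * norm (inverse_fourier (g p) x))" for x
    proof -
      have "of_real ((h \<bullet> \<xi>)\<^sup>2) * f \<xi> = (\<Sum>p\<in>Basis \<times> Basis. of_real ((h \<bullet> fst p) * (h \<bullet> snd p)) * g p \<xi>)" for \<xi>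
      proof -
        have "(h \<bullet> \<xi>)\<^sup>2 = (\<Sum>p\<in>Basis \<times> Basis. (h \<bullet> fst p) * (h \<bullet> snd p) * ((\<xi> \<bullet> fst p) * (\<xi> \<bullet> snd p)))"
          unfolding euclidean_inner[of h \<xi>] power2_eq_square sum_product sum.cartesian_product
          by (auto intro!: sum.cong simp: mult_ac)
        then show ?thesis
          by (simp add: sum_distrib_left sum_distrib_right g_def mult_ac)
      qed
      then have "F h x = inverse_fourier (\<lambda>\<xi>. \<Sum>p\<in>Basis \<times> Basis. of_real ((h \<bullet> fst p) * (h \<bullet> snd p)) * g p \<xi>) x"
        unfolding F_def by presburger
      also have "\<dots> = (\<Sum>p\<in>Basis \<times> Basis. of_real ((h \<bullet> fst p) * (h \<bullet> snd p)) * inverse_fourier (g p) x)"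
        unfolding inverse_fourier_cmult[symmetric]
        by (rule inverse_fourier_sum) (intro integrable_mult_right Cc_infinity_integrable g)
      also have "norm \<dots> \<le> (\<Sum>p\<in>Basis \<times> Basis. (norm h)\<^sup>2 * norm (inverse_fourier (g p) x))"
      proof (rule sum_norm_le)
        fix p :: "'a \<times> 'a" assume "p \<in> Basis \<times> Basis"
        then have "\<bar>h \<bullet> fst p\<bar> * \<bar>h \<bullet> snd p\<bar> \<le> norm h * norm h"
          by (intro mult_mono) (auto intro: Basis_le_norm)
        then show "norm (of_real ((h \<bullet> fst p) * (h \<bullet> snd p)) * inverse_fourier (g p) x)
            \<le> (norm h)\<^sup>2 * norm (inverse_fourier (g p) x)"
          by (simp add: norm_mult power2_eq_square mult_right_mono)
      qed
      finally show ?thesis .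
    qed
    then have "(\<integral>\<^sup>+ x. norm (F h x) \<partial>lborel)
        \<le> (\<integral>\<^sup>+ x. ennreal (\<Sum>p\<in>Basis \<times> Basis. (norm h)\<^sup>2 * norm (inverse_fourier (g p) x)) \<partial>lborel)"
      by (intro nn_integral_mono ennreal_leI)
    also have "\<dots> = (\<integral>\<^sup>+ x. (\<Sum>p\<in>Basis \<times> Basis. ennreal ((norm h)\<^sup>2) * ennreal (norm (inverse_fourier (g p) x))) \<partial>lborel)"
      by (simp add: ennreal_mult flip: sum_ennreal)
    also have "\<dots> = ennreal ((norm h)\<^sup>2) * K"
      by (simp add: K_def nn_integral_sum nn_integral_cmult sum_distrib_left)
    finally show ?thesis .
  qed
  have small: "(\<integral>\<^sup>+ x. norm (second_difference (inverse_fourier f) h x) \<partial>lborel) \<le> 2 * (ennreal ((norm h)\<^sup>2) * K)" for h :: 'a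
  proof -
    have "(\<integral>\<^sup>+ x. norm (second_difference (inverse_fourier f) h x) \<partial>lborel)
        \<le> (\<integral>\<^sup>+ x. \<integral>\<^sup>+ t. indicator {0..1} t * (ennreal (norm (F h (x + t *\<^sub>R h))) + ennreal (norm (F h (x + - (t *\<^sub>R h))))) \<partial>lborel \<partial>lborel)"
    proof (rule nn_integral_mono)
      fix x
      have "ennreal (norm (second_difference (inverse_fourier f) h x))
          \<le> (\<integral>\<^sup>+ t. norm (of_real (indicator {0..1} t * (1 - t)) * (F h (x + t *\<^sub>R h) + F h (x - t *\<^sub>R h))) \<partial>lborel)"
        unfolding second_difference_inverse_fourier_integral[OF f] F_def norm_minus_cancel
        by (rule ennreal_norm_integral_le_nn_integral)
      also have "\<dots> \<le> (\<integral>\<^sup>+ t. indicator {0..1} t * (ennreal (norm (F h (x + t *\<^sub>R h))) + ennreal (norm (F h (x + - (t *\<^sub>R h))))) \<partial>lborel)"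
      proof (rule nn_integral_mono)
        fix t :: real
        \<comment> \<open>On the unit interval the weight \<open>1 - t\<close> is estimated by
          1.\<close>
        have "norm (of_real (indicator {0..1} t * (1 - t)) * (F h (x + t *\<^sub>R h) + F h (x - t *\<^sub>R h)))
            \<le> indicator {0..1} t * (norm (F h (x + t *\<^sub>R h)) + norm (F h (x - t *\<^sub>R h)))"
          unfolding norm_mult norm_of_real
          by (intro mult_mono norm_triangle_ineq) (auto simp: indicator_def)
        then show "ennreal (norm (of_real (indicator {0..1} t * (1 - t)) * (F h (x + t *\<^sub>R h) + F h (x - t *\<^sub>R h))))
            \<le> indicator {0..1} t * (ennreal (norm (F h (x + t *\<^sub>R h))) + ennreal (norm (F h (x + - (t *\<^sub>R h)))))"
          by (auto simp: indicator_def simp flip: ennreal_plus intro!: ennreal_leI)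
      qed
      finally show "ennreal (norm (second_difference (inverse_fourier f) h x))
          \<le> (\<integral>\<^sup>+ t. indicator {0..1} t * (ennreal (norm (F h (x + t *\<^sub>R h))) + ennreal (norm (F h (x + - (t *\<^sub>R h))))) \<partial>lborel)" .
    qed
    \<comment> \<open>After Tonelli the inner integral runs over \<open>x\<close>, so translation
      invariance removes both shifts and the integral over the unit interval contributes the factor
      1.\<close>
    also have "\<dots> = (\<integral>\<^sup>+ t. \<integral>\<^sup>+ x. indicator {0..1} t * (ennreal (norm (F h (x + t *\<^sub>R h))) + ennreal (norm (F h (x + - (t *\<^sub>R h))))) \<partial>lborel \<partial>lborel)"
      by (rule lborel_pair.Fubini') measurable
    also have "\<dots> = (\<integral>\<^sup>+ t. indicator {0..1::real} t * (2 * (\<integral>\<^sup>+ x. norm (F h x) \<partial>lborel)) \<partial>lborel)"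
      using lborel_nn_integral_translate[of "\<lambda>x. ennreal (norm (F h x))"]
      by (simp add: nn_integral_cmult nn_integral_add mult_2 del: add_uminus_conv_diff)
    also have "\<dots> = 2 * (\<integral>\<^sup>+ x. norm (F h x) \<partial>lborel)"
      by (subst nn_integral_multc) auto
    also have "\<dots> \<le> 2 * (ennreal ((norm h)\<^sup>2) * K)"
      using F_le by (intro mult_left_mono) auto
    finally show ?thesis .
  qed
  have large: "(\<integral>\<^sup>+ x. norm (second_difference (inverse_fourier f) h x) \<partial>lborel) \<le> 4 * I" for h :: 'a
    unfolding I_def by (rule nn_integral_second_difference_le) measurable
  define C where "C = enn2real (4 * I) + enn2real (2 * K)"
  \<comment> \<open>Finiteness of \<open>I\<close> and \<open>K\<close> ensures that
    \<open>enn2real\<close> loses nothing.\<close>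
  have C: "ennreal C = 4 * I + 2 * K"
    using \<open>I < \<infinity>\<close> \<open>K < \<infinity>\<close> by (simp add: C_def ennreal_plus ennreal_mult_less_top)
  show ?thesis
  proof (rule that[of C])
    show "0 \<le> C"
      by (simp add: C_def)
    fix h :: 'a
    have "4 * I * ennreal (min 1 ((norm h)\<^sup>2)) + 2 * K * ennreal (min 1 ((norm h)\<^sup>2)) = ennreal (C * min 1 ((norm h)\<^sup>2))"
      by (simp add: ennreal_mult \<open>0 \<le> C\<close> C distrib_right)
    moreover have "(\<integral>\<^sup>+ x. norm (second_difference (inverse_fourier f) h x) \<partial>lborel) \<le>
       4 * I * ennreal (min 1 ((norm h)\<^sup>2)) + 2 * K * ennreal (min 1 ((norm h)\<^sup>2))"
    \<comment> \<open>In each case one summand dominates already and the other is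
      nonnegative.\<close>
    proof (cases "(norm h)\<^sup>2 \<le> 1")
      case True
      then show ?thesis
        using small[of h] by (simp add: min_absorb2 mult_ac add_increasing)
    next
      case False
      then show ?thesis
        using large[of h] by (simp add: min_absorb1 add_increasing2)
    qed
    ultimately show "(\<integral>\<^sup>+ x. norm (second_difference (inverse_fourier f) h x) \<partial>lborel) \<le> ennreal (C * min 1 ((norm h)\<^sup>2))"
      by simp
  qed
qed

section \<open>The Levy symbol\<close>

lemma levy_measure_space: "levy_measure \<mu> \<Longrightarrow> space \<mu> = UNIV"
  using sets_eq_imp_space_eq[of \<mu> borel] by (simp add: levy_measure_def)

lemma levy_measure_integrable_min:
  assumes "levy_measure \<mu>"
  shows "integrable \<mu> (\<lambda>y. min 1 ((norm y)\<^sup>2))"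
proof (rule integrableI_nonneg)
  have [measurable_cong]: "sets \<mu> = sets borel"
    using assms by (simp add: levy_measure_def)
  show "(\<lambda>y. min 1 ((norm y)\<^sup>2)) \<in> borel_measurable \<mu>"
    by measurable
qed (use assms in \<open>auto simp: levy_measure_def\<close>)

text \<open>Makes Fubini and Tonelli available for \<open>\<mu>\<close> paired with Lebesgue
  measure. By Markov's inequality, the sets where the Levy weight is at least 1/(n+1) have finite
  measure; they exhaust everything but the origin, which is a null set.\<close>

lemma levy_measure_sigma_finite:
  fixes \<mu> :: "'a::euclidean_space measure"
  assumes "levy_measure \<mu>"
  shows "sigma_finite_measure \<mu>"
proof
  have [measurable_cong]: "sets \<mu> = sets borel" and zero: "emeasure \<mu> {0} = 0"
    and fin: "(\<integral>\<^sup>+ y. ennreal (min 1 ((norm y)\<^sup>2)) \<partial>\<mu>) < \<infinity>"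
    using assms by (auto simp: levy_measure_def)
  have [simp]: "space \<mu> = UNIV"
    using assms by (rule levy_measure_space)
  define A where "A = (\<lambda>n. {y::'a. 1 \<le> ennreal (real (Suc n)) * ennreal (min 1 ((norm y)\<^sup>2))})"
  have meas: "A n \<in> sets \<mu>" for n
    unfolding A_def by measurable
  have "emeasure \<mu> (A n) < \<infinity>" for n
  proof -
    have "emeasure \<mu> ({y\<in>UNIV. 1 \<le> ennreal (real (Suc n)) * ennreal (min 1 ((norm y)\<^sup>2))})
        \<le> ennreal (real (Suc n)) * (\<integral>\<^sup>+ y. ennreal (min 1 ((norm y)\<^sup>2)) * indicator UNIV y \<partial>\<mu>)"
      by (rule nn_integral_Markov_inequality) auto
    also have "\<dots> < \<infinity>"
      using fin by (simp add: ennreal_mult_less_top del: of_nat_Suc)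
    finally show ?thesis
      by (simp add: A_def)
  qed
  moreover have "(\<Union>n. A n) \<union> {0} = UNIV"
  proof -
    have "y \<in> (\<Union>n. A n)" if "y \<noteq> 0" for y
    proof -
      have pos: "0 < min 1 ((norm y)\<^sup>2)"
        using that by simp
      obtain n where "1 < real n * min 1 ((norm y)\<^sup>2)"
        using reals_Archimedean3[OF pos] by blast
      also have "\<dots> \<le> real (Suc n) * min 1 ((norm y)\<^sup>2)"
        by (intro mult_right_mono) auto
      finally have "1 < real (Suc n) * min 1 ((norm y)\<^sup>2)" .
      then have "ennreal 1 \<le> ennreal (real (Suc n) * min 1 ((norm y)\<^sup>2))"
        by (intro ennreal_leI) simp
      then show ?thesis
        unfolding A_def by (auto simp: ennreal_mult simp del: of_nat_Suc)
    qed
    then show ?thesis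
      by auto
  qed
  ultimately show "\<exists>\<A>. countable \<A> \<and> \<A> \<subseteq> sets \<mu> \<and> \<Union> \<A> = space \<mu> \<and> (\<forall>a\<in>\<A>. emeasure \<mu> a \<noteq> \<infinity>)"
    using meas zero by (intro exI[of _ "insert {0} (range A)"]) (auto simp: less_top)
qed

text \<open>First-order Taylor remainder of the exponential on the imaginary axis, where the real
  part of the argument contributes no growth.\<close>

lemma norm_iexp_minus_1_le:
  fixes u :: real
  shows "norm (exp (\<i> * of_real u) - 1 - \<i> * of_real u) \<le> u\<^sup>2"
  using Taylor_exp[of "\<i> * of_real u" 1] by (simp add: power2_eq_square norm_mult diff_diff_eq)

text \<open>In the unit ball the Taylor remainder gives a quadratic bound, and outside it the
  trivial bound 2 suffices; the constant covers both. The result is a product of a function of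
  \<open>\<xi>\<close> and one of \<open>y\<close>, as Fubini will require.\<close>

lemma abs_cos_minus_1_le:
  fixes y \<xi> :: "'a::euclidean_space"
  shows "\<bar>cos (y \<bullet> \<xi>) - 1\<bar> \<le> (2 + (norm \<xi>)\<^sup>2) * min 1 ((norm y)\<^sup>2)"
proof (cases "norm y \<le> 1")
  case True
  have "\<bar>cos (y \<bullet> \<xi>) - 1\<bar> \<le> (y \<bullet> \<xi>)\<^sup>2"
    using abs_Re_le_cmod[of "exp (\<i> * of_real (y \<bullet> \<xi>)) - 1 - \<i> * of_real (y \<bullet> \<xi>)"]
      norm_iexp_minus_1_le[of "y \<bullet> \<xi>"] by (simp add: Re_exp)
  also have "\<dots> \<le> (norm y * norm \<xi>)\<^sup>2"
    using Cauchy_Schwarz_ineq2[of y \<xi>] by (metis abs_ge_zero power2_abs power_mono)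
  also have "\<dots> \<le> (2 + (norm \<xi>)\<^sup>2) * (norm y)\<^sup>2"
    by (simp add: power_mult_distrib algebra_simps)
  finally show ?thesis
    using True by (simp add: min_absorb2 power_le_one)
next
  case False
  then have "1 \<le> (norm y)\<^sup>2"
    by simp
  moreover have "\<bar>cos (y \<bullet> \<xi>) - 1\<bar> \<le> 2 + (norm \<xi>)\<^sup>2"
    using cos_ge_minus_one[of "y \<bullet> \<xi>"] cos_le_one[of "y \<bullet> \<xi>"] zero_le_power2[of "norm \<xi>"] by arith
  ultimately show ?thesis
    by simp
qed

text \<open>Negation is an involution, so preimages under it are images; symmetry becomes a change
  of variables.\<close>

lemma symmetric_measure_distr_uminus:
  fixes \<mu> :: "'a::euclidean_space measure"
  assumes [measurable_cong]: "sets \<mu> = sets borel" and "symmetric_measure \<mu>"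
  shows "distr \<mu> \<mu> uminus = \<mu>"
proof (rule measure_eqI)
  fix A assume "A \<in> sets (distr \<mu> \<mu> uminus)"
  then have A: "A \<in> sets \<mu>"
    by simp
  have "uminus -` A \<inter> space \<mu> = uminus ` A"
    using sets_eq_imp_space_eq[OF assms(1)] by force
  moreover have "uminus \<in> measurable \<mu> \<mu>"
    by measurable
  ultimately show "emeasure (distr \<mu> \<mu> uminus) A = emeasure \<mu> A"
    using assms(2) A by (simp add: emeasure_distr symmetric_measure_def)
qed simp

text \<open>Averaging over \<open>y\<close> and \<open>- y\<close> cancels the compensator, which is
  odd because the unit ball is symmetric, and turns the exponentials into a cosine.\<close>

lemma levy_symbol_symmetric:
  fixes \<mu> :: "'a::euclidean_space measure"
  assumes \<mu>: "levy_measure \<mu>" and sym: "symmetric_measure \<mu>"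
  shows "levy_symbol \<mu> \<xi> = (LINT y|\<mu>. of_real (cos (y \<bullet> \<xi>) - 1))"
proof -
  define f where "f = (\<lambda>y. exp (\<i> * of_real (y \<bullet> \<xi>)) - 1
     - \<i> * of_real (y \<bullet> \<xi>) * indicator {y. norm y \<le> 1} y)"
  have [measurable_cong]: "sets \<mu> = sets borel"
    using \<mu> by (simp add: levy_measure_def)
  \<comment> \<open>The compensated integrand as a whole must be integrable before the integrals
    over \<open>y\<close> and \<open>- y\<close> may be added.\<close>
  have f_le: "norm (f y) \<le> (2 + (norm \<xi>)\<^sup>2) * min 1 ((norm y)\<^sup>2)" for y
  proof (cases "norm y \<le> 1")
    case True
    then have "norm (f y) \<le> (y \<bullet> \<xi>)\<^sup>2"
      using norm_iexp_minus_1_le[of "y \<bullet> \<xi>"] by (simp add: f_def)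
    also have "\<dots> \<le> (norm y * norm \<xi>)\<^sup>2"
      using Cauchy_Schwarz_ineq2[of y \<xi>] by (metis abs_ge_zero power2_abs power_mono)
    also have "\<dots> \<le> (2 + (norm \<xi>)\<^sup>2) * (norm y)\<^sup>2"
      by (simp add: power_mult_distrib algebra_simps)
    finally show ?thesis
      using True by (simp add: min_absorb2 power_le_one)
  next
    case False
    then have "norm (f y) \<le> 2"
      using norm_triangle_ineq4[of "exp (\<i> * of_real (y \<bullet> \<xi>))" 1] by (simp add: f_def)
    moreover have "1 \<le> (norm y)\<^sup>2"
      using False by simp
    ultimately show ?thesis
      by (simp add: min_absorb1 add_increasing2)
  qed
  have f: "integrable \<mu> f"
  proof (rule Bochner_Integration.integrable_bound)
    show "integrable \<mu> (\<lambda>y. (2 + (norm \<xi>)\<^sup>2) * min 1 ((norm y)\<^sup>2))"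
      using levy_measure_integrable_min[OF \<mu>] by simp
    show "f \<in> borel_measurable \<mu>"
      unfolding f_def by measurable
  qed (use f_le in \<open>auto intro: order_trans[OF _ abs_ge_self]\<close>)
  have distr: "distr \<mu> \<mu> uminus = \<mu>"
    using sym \<mu> by (intro symmetric_measure_distr_uminus) (auto simp: levy_measure_def)
  have "integrable (distr \<mu> \<mu> uminus) f" and "(LINT y|\<mu>. f y) = (LINT y|distr \<mu> \<mu> uminus. f y)"
    using f by (simp_all add: distr)
  then have f': "integrable \<mu> (\<lambda>y. f (- y))" and eq: "(LINT y|\<mu>. f y) = (LINT y|\<mu>. f (- y))"
    using f by (simp_all add: integrable_distr_eq integral_distr)
  have "2 * levy_symbol \<mu> \<xi> = (LINT y|\<mu>. f y) + (LINT y|\<mu>. f (- y))"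
    unfolding eq[symmetric] by (simp add: levy_symbol_def f_def)
  also have "\<dots> = (LINT y|\<mu>. f y + f (- y))"
    using f f' by simp
  also have "\<dots> = (LINT y|\<mu>. 2 * of_real (cos (y \<bullet> \<xi>) - 1))"
    using iexp_add_iexp_minus[of "y \<bullet> \<xi>" for y]
    by (intro Bochner_Integration.integral_cong) (auto simp: f_def indicator_def algebra_simps)
  also have "\<dots> = 2 * (LINT y|\<mu>. of_real (cos (y \<bullet> \<xi>) - 1))"
    by (rule integral_mult_right_zero)
  finally show ?thesis
    by simp
qed

section \<open>The operator as an integral of second differences\<close>

lemma inverse_fourier_levy_symbol:
  fixes \<mu> :: "'a::euclidean_space measure" and g :: "'a \<Rightarrow> complex"
  assumes \<mu>: "levy_measure \<mu>" and sym: "symmetric_measure \<mu>" and g: "g \<in> Cc_infinity UNIV"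
  shows "inverse_fourier (\<lambda>\<xi>. levy_symbol \<mu> (a *\<^sub>R \<xi>) * g \<xi>) x
    = (LINT y|\<mu>. second_difference (inverse_fourier g) (a *\<^sub>R y) x / 2)"
proof -
  interpret \<mu>: sigma_finite_measure \<mu>
    using \<mu> by (rule levy_measure_sigma_finite)
  interpret pair_sigma_finite lborel \<mu> ..
  let ?c = "complex_of_real ((2 * pi) powr (- real DIM('a) / 2))"
  have [measurable_cong]: "sets \<mu> = sets borel"
    using \<mu> by (simp add: levy_measure_def)
  note [measurable] = Cc_infinity_borel_measurable[OF g]
  \<comment> \<open>The dilation is carried over from \<open>\<xi>\<close> to the jump
    \<open>y\<close> within the inner product, so that a step of length proportional to
    \<open>y\<close> appears.\<close>
  define k where "k = (\<lambda>\<xi> y. exp (\<i> * of_real (x \<bullet> \<xi>)) * (of_real (cos ((a *\<^sub>R y) \<bullet> \<xi>) - 1) * g \<xi>))"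
  \<comment> \<open>On the support of \<open>g\<close> the frequency is bounded, so the
    \<open>\<xi>\<close>-dependent constant in the cosine bound can be replaced by a fixed one;
    elsewhere \<open>k\<close> vanishes.\<close>
  obtain R where R: "norm \<xi> \<le> R" if "g \<xi> \<noteq> 0" for \<xi>
    using g by (auto simp: Cc_infinity_UNIV_iff bounded_iff)
  have k: "integrable (lborel \<Otimes>\<^sub>M \<mu>) (case_prod k)"
  proof (rule integrable_bounded_by_product)
    show "case_prod k \<in> borel_measurable (lborel \<Otimes>\<^sub>M \<mu>)"
      unfolding k_def by measurable
    show "integrable lborel (\<lambda>\<xi>. (2 + (\<bar>a\<bar> * R)\<^sup>2) * norm (g \<xi>))"
      using Cc_infinity_integrable[OF g] by simp
    show "integrable \<mu> (\<lambda>y. min 1 ((norm y)\<^sup>2))"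
      using \<mu> by (rule levy_measure_integrable_min)
    fix \<xi> y
    show "norm (case (\<xi>, y) of (\<xi>, y) \<Rightarrow> k \<xi> y) \<le> (2 + (\<bar>a\<bar> * R)\<^sup>2) * norm (g \<xi>) * min 1 ((norm y)\<^sup>2)"
    proof (cases "g \<xi> = 0")
      case False
      have "norm (k \<xi> y) = \<bar>cos (y \<bullet> (a *\<^sub>R \<xi>)) - 1\<bar> * norm (g \<xi>)"
        unfolding k_def norm_mult norm_of_real by simp
      also have "\<dots> \<le> (2 + (norm (a *\<^sub>R \<xi>))\<^sup>2) * min 1 ((norm y)\<^sup>2) * norm (g \<xi>)"
        by (intro mult_right_mono abs_cos_minus_1_le) auto
      also have "\<dots> \<le> (2 + (\<bar>a\<bar> * R)\<^sup>2) * min 1 ((norm y)\<^sup>2) * norm (g \<xi>)"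
        using R[OF False] by (intro mult_right_mono add_left_mono power_mono) (auto intro: mult_left_mono)
      finally show ?thesis
        by (simp add: mult_ac)
    qed (simp add: k_def)
  qed
  have "inverse_fourier (\<lambda>\<xi>. levy_symbol \<mu> (a *\<^sub>R \<xi>) * g \<xi>) x = ?c * (LINT \<xi>|lborel. LINT y|\<mu>. k \<xi> y)"
  proof -
    have "exp (\<i> * of_real (x \<bullet> \<xi>)) * (levy_symbol \<mu> (a *\<^sub>R \<xi>) * g \<xi>) = (LINT y|\<mu>. k \<xi> y)" for \<xi>
      unfolding levy_symbol_symmetric[OF \<mu> sym] k_def integral_mult_right_zero integral_mult_left_zero
      by (simp only: inner_scaleR_left inner_scaleR_right)
    then show ?thesis
      by (simp add: inverse_fourier_def)
  qed
  also have "\<dots> = (LINT y|\<mu>. ?c * (LINT \<xi>|lborel. k \<xi> y))"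
    using Fubini_integral[OF k] by simp
  also have "(\<lambda>y. ?c * (LINT \<xi>|lborel. k \<xi> y)) = (\<lambda>y. second_difference (inverse_fourier g) (a *\<^sub>R y) x / 2)"
  proof
    fix y
    have "second_difference (inverse_fourier g) (a *\<^sub>R y) x
        = inverse_fourier (\<lambda>\<xi>. 2 * (of_real (cos ((a *\<^sub>R y) \<bullet> \<xi>) - 1) * g \<xi>)) x"
      unfolding second_difference_inverse_fourier[OF Cc_infinity_integrable[OF g]]
      by (simp only: of_real_mult of_real_numeral mult.assoc)
    then show "?c * (LINT \<xi>|lborel. k \<xi> y) = second_difference (inverse_fourier g) (a *\<^sub>R y) x / 2"
      unfolding inverse_fourier_cmult by (simp add: inverse_fourier_def k_def)
  qed
  finally show ?thesis .
qed

text \<open>The constant comes from the second-difference bound for \<open>g\<close>, hence is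
  uniform in \<open>a\<close>; this yields one constant for all scales \<open>r\<close>.\<close>

lemma nn_integral_inverse_fourier_levy_symbol_le:
  fixes \<mu> :: "'a::euclidean_space measure" and g :: "'a \<Rightarrow> complex"
  assumes \<mu>: "levy_measure \<mu>" and sym: "symmetric_measure \<mu>" and g: "g \<in> Cc_infinity UNIV"
  obtains C :: real where "0 \<le> C"
    "\<And>a. inverse_fourier (\<lambda>\<xi>. levy_symbol \<mu> (a *\<^sub>R \<xi>) * g \<xi>) \<in> borel_measurable borel"
    "\<And>a. (\<integral>\<^sup>+ x. norm (inverse_fourier (\<lambda>\<xi>. levy_symbol \<mu> (a *\<^sub>R \<xi>) * g \<xi>) x) \<partial>lborel)
       \<le> ennreal C * (\<integral>\<^sup>+ y. ennreal (min 1 ((norm (a *\<^sub>R y))\<^sup>2)) \<partial>\<mu>)"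
proof -
  interpret \<mu>: sigma_finite_measure \<mu>
    using \<mu> by (rule levy_measure_sigma_finite)
  interpret pair_sigma_finite lborel \<mu> ..
  let ?D = "\<lambda>a x y. second_difference (inverse_fourier g) (a *\<^sub>R y) x"
  have [measurable_cong]: "sets \<mu> = sets borel"
    using \<mu> by (simp add: levy_measure_def)
  have [measurable]: "inverse_fourier g \<in> borel_measurable borel"
    by (intro borel_measurable_inverse_fourier Cc_infinity_borel_measurable g)
  obtain C where "0 \<le> C" and
    C: "\<And>h. (\<integral>\<^sup>+ x. norm (second_difference (inverse_fourier g) h x) \<partial>lborel) \<le> ennreal (C * min 1 ((norm h)\<^sup>2))"
    using nn_integral_second_difference_inverse_fourier_le[OF g] by blast
  show ?thesis
  proof (rule that[OF \<open>0 \<le> C\<close>])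
    fix a
    show "inverse_fourier (\<lambda>\<xi>. levy_symbol \<mu> (a *\<^sub>R \<xi>) * g \<xi>) \<in> borel_measurable borel"
      \<comment> \<open>Measurability is read off from the representation as a parameter integral
        over \<open>\<mu>\<close>.\<close>
      unfolding inverse_fourier_levy_symbol[OF assms, abs_def] by measurable
    have "(\<integral>\<^sup>+ x. norm (inverse_fourier (\<lambda>\<xi>. levy_symbol \<mu> (a *\<^sub>R \<xi>) * g \<xi>) x) \<partial>lborel)
        \<le> (\<integral>\<^sup>+ x. \<integral>\<^sup>+ y. norm (?D a x y) \<partial>\<mu> \<partial>lborel)"
      unfolding inverse_fourier_levy_symbol[OF assms]
    proof (rule nn_integral_mono)
      fix x
      have "ennreal (norm (LINT y|\<mu>. ?D a x y / 2)) \<le> (\<integral>\<^sup>+ y. norm (?D a x y / 2) \<partial>\<mu>)"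
        by (rule ennreal_norm_integral_le_nn_integral)
      also have "\<dots> \<le> (\<integral>\<^sup>+ y. norm (?D a x y) \<partial>\<mu>)"
        by (intro nn_integral_mono ennreal_leI) (simp add: norm_divide)
      finally show "ennreal (norm (LINT y|\<mu>. ?D a x y / 2)) \<le> (\<integral>\<^sup>+ y. norm (?D a x y) \<partial>\<mu>)" .
    qed
    also have "\<dots> = (\<integral>\<^sup>+ y. \<integral>\<^sup>+ x. norm (?D a x y) \<partial>lborel \<partial>\<mu>)"
      by (rule Fubini'[symmetric]) measurable
    also have "\<dots> \<le> (\<integral>\<^sup>+ y. ennreal C * ennreal (min 1 ((norm (a *\<^sub>R y))\<^sup>2)) \<partial>\<mu>)"
      using C \<open>0 \<le> C\<close> by (intro nn_integral_mono) (simp only: ennreal_mult[symmetric] min.bounded_iff zero_le_one zero_le_power2)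
    also have "\<dots> = ennreal C * (\<integral>\<^sup>+ y. ennreal (min 1 ((norm (a *\<^sub>R y))\<^sup>2)) \<partial>\<mu>)"
      by (rule nn_integral_cmult) measurable
    finally show "(\<integral>\<^sup>+ x. norm (inverse_fourier (\<lambda>\<xi>. levy_symbol \<mu> (a *\<^sub>R \<xi>) * g \<xi>) x) \<partial>lborel)
       \<le> ennreal C * (\<integral>\<^sup>+ y. ennreal (min 1 ((norm (a *\<^sub>R y))\<^sup>2)) \<partial>\<mu>)" .
  qed
qed

theorem proposition3p6:
  fixes \<mu> :: "'a::euclidean_space measure"
    and R\<^sub>0 :: ereal
    and s s\<^sub>L s\<^sub>U :: "real \<Rightarrow> real"
  assumes "scaling_triple R\<^sub>0 s s\<^sub>L s\<^sub>U"
    and "levy_measure \<mu>" and "symmetric_measure \<mu>"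
    and "(SUP r\<in>{0<..}. ennreal (s r) *
           (\<integral>\<^sup>+ y. ennreal (min 1 ((norm (inverse r *\<^sub>R y))\<^sup>2)) \<partial>\<mu>)) < \<infinity>"
  shows "\<forall>\<phi> \<in> schwartz.
           fourier \<phi> \<in> Cc_infinity
             (ball 0 (scaling_const s\<^sub>L) - ball 0 (inverse (scaling_const s\<^sub>L))) \<longrightarrow>
           (\<exists>N\<^sub>2::real. 0 < N\<^sub>2 \<and>
              (\<forall>r. 0 < r \<and> r < 1 \<longrightarrow>
                 integrable lborel
                   (fourier_multiplier (\<lambda>\<xi>. levy_symbol \<mu> (inverse r *\<^sub>R \<xi>)) \<phi>) \<and>
                 (LINT x|lborel.
                    norm (fourier_multiplier (\<lambda>\<xi>. levy_symbol \<mu> (inverse r *\<^sub>R \<xi>)) \<phi> x))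
                 \<le> N\<^sub>2 / s r))"
proof (intro ballI impI)
  fix \<phi> :: "'a \<Rightarrow> complex"
  assume "fourier \<phi> \<in> Cc_infinity (ball 0 (scaling_const s\<^sub>L) - ball 0 (inverse (scaling_const s\<^sub>L)))"
  then have "fourier \<phi> \<in> Cc_infinity UNIV"
    by (simp add: Cc_infinity_def)
  then obtain C :: real where "0 \<le> C"
    and meas: "\<And>a. fourier_multiplier (\<lambda>\<xi>. levy_symbol \<mu> (a *\<^sub>R \<xi>)) \<phi> \<in> borel_measurable borel"
    and C: "\<And>a. (\<integral>\<^sup>+ x. norm (fourier_multiplier (\<lambda>\<xi>. levy_symbol \<mu> (a *\<^sub>R \<xi>)) \<phi> x) \<partial>lborel)
       \<le> ennreal C * (\<integral>\<^sup>+ y. ennreal (min 1 ((norm (a *\<^sub>R y))\<^sup>2)) \<partial>\<mu>)"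
    unfolding fourier_multiplier_def
    by (rule nn_integral_inverse_fourier_levy_symbol_le[OF assms(2,3)]) blast
  define S where "S = (SUP r\<in>{0<..}. ennreal (s r) *
           (\<integral>\<^sup>+ y. ennreal (min 1 ((norm (inverse r *\<^sub>R y))\<^sup>2)) \<partial>\<mu>))"
  have "ennreal (enn2real S) = S"
    using assms(4) by (simp add: S_def)
  \<comment> \<open>The summand 1 secures strict positivity when \<open>C\<close> or the supremum is
    0.\<close>
  define N where "N = C * enn2real S + 1"
  have "0 < N"
    using \<open>0 \<le> C\<close> by (simp add: N_def add_nonneg_pos)
  show "\<exists>N\<^sub>2::real. 0 < N\<^sub>2 \<and> (\<forall>r. 0 < r \<and> r < 1 \<longrightarrow>
      integrable lborel (fourier_multiplier (\<lambda>\<xi>. levy_symbol \<mu> (inverse r *\<^sub>R \<xi>)) \<phi>) \<and>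
      (LINT x|lborel. norm (fourier_multiplier (\<lambda>\<xi>. levy_symbol \<mu> (inverse r *\<^sub>R \<xi>)) \<phi> x)) \<le> N\<^sub>2 / s r)"
  proof (intro exI[of _ N] conjI[OF \<open>0 < N\<close>] allI impI)
    fix r :: real assume "0 < r \<and> r < 1"
    then have "0 < s r"
      using assms(1) by (auto simp: scaling_triple_def)
    let ?M = "fourier_multiplier (\<lambda>\<xi>. levy_symbol \<mu> (inverse r *\<^sub>R \<xi>)) \<phi>"
    let ?W = "\<integral>\<^sup>+ y. ennreal (min 1 ((norm (inverse r *\<^sub>R y))\<^sup>2)) \<partial>\<mu>"
    have "ennreal (inverse (s r)) * ennreal (s r) = 1"
      using \<open>0 < s r\<close> by (simp flip: ennreal_mult)
    \<comment> \<open>Inserting the factor \<open>s r\<close> and its inverse exposes a member of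
      the family whose supremum is \<open>S\<close>.\<close>
    then have "?W = ennreal (inverse (s r)) * (ennreal (s r) * ?W)"
      by (metis mult.assoc mult_1)
    also have "\<dots> \<le> ennreal (inverse (s r)) * S"
      unfolding S_def using \<open>0 < r \<and> r < 1\<close> by (intro mult_left_mono SUP_upper) auto
    finally have "ennreal C * ?W \<le> ennreal C * (ennreal (inverse (s r)) * ennreal (enn2real S))"
      unfolding \<open>ennreal (enn2real S) = S\<close> by (rule mult_left_mono) simp
    also have "\<dots> = ennreal (C * (inverse (s r) * enn2real S))"
      using \<open>0 \<le> C\<close> \<open>0 < s r\<close> by (simp add: ennreal_mult)
    also have "\<dots> \<le> ennreal (N / s r)"
      using \<open>0 < s r\<close> by (intro ennreal_leI) (simp add: N_def field_simps)
    finally have le: "(\<integral>\<^sup>+ x. norm (?M x) \<partial>lborel) \<le> ennreal (N / s r)"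
      by (rule order_trans[OF C])
    \<comment> \<open>The estimate of the nonnegative integral is finite, which gives integrability;
      only then may it be read as a bound on the Bochner integral.\<close>
    have M: "integrable lborel ?M"
    proof (rule integrableI_bounded)
      show "(\<integral>\<^sup>+ x. norm (?M x) \<partial>lborel) < \<infinity>"
        using le by (rule le_less_trans) simp
    qed (simp add: meas)
    then have "ennreal (LINT x|lborel. norm (?M x)) \<le> ennreal (N / s r)"
      using le by (simp add: nn_integral_eq_integral)
    then show "integrable lborel ?M \<and> (LINT x|lborel. norm (?M x)) \<le> N / s r"
      using M \<open>0 < N\<close> \<open>0 < s r\<close> by (simp add: ennreal_le_iff)
  qed
qed

end
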